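(* Consider the data-sharing problem (P) described in the context, with objective $L(\boldsymbol{\pi})$ over policy sequences $\boldsymbol{\pi}=\{\pi_t\}_{t=1}^T$ of the general form $\pi_t(Y_t\mid\Theta,X^A_{1:t},Y_{1:t-1},X^B_{1:t})$ and distortion constraints $\mathbb{E}^{\pi_t}[d(X_t^A,Y_t)]\le\hat D$ for $t=1,\dots,T$. Let $\boldsymbol{\pi^*}$ be an optimal sequence of policies for (P), and let $\boldsymbol{\Pi^s}$ be the set of sequences of simplified policies $\boldsymbol{\pi^s}=\{\pi^s_t\}_{t=1}^T$ of the form $\pi^s_t(Y_t\mid\Theta,X^A_t,X^B_{1:t},Y_{1:t-1})$ (no dependence on $X^A_{1:t-1}$). Then there exists $\boldsymbol{\pi^{s,*}}\in\boldsymbol{\Pi^s}$ that is an optimal solution of (P); specifically, (i) $L(\boldsymbol{\pi^{s,*}})=L(\boldsymbol{\pi^*})$, and (ii) $\mathbb{E}^{\pi^{s,*}_t}[d(X_t^A,Y_t)]\le\hat D$ for all $t=1,2,\dots,T$.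
   Context: System. Time steps are $t=1,\dots,T$. $A$ (data provider) has state $X^A_t\in\mathbb{R}^{N_A}$ and $B$ (data user) has state $X^B_t\in\mathbb{R}^{N_B}$. $\Theta$ is a time-invariant random (vector) parameter with prior $p(\Theta)$; $\theta^*$ is a fixed value (its true value). All laws are assumed to be described by densities (or mass functions) written $p(\cdot\mid\cdot)$. The initial triple $(\Theta,X^A_1,X^B_1)$ has a given joint law. At each time $t$, shared data $Y_t$ is drawn from a policy kernel $\pi_t(Y_t\mid\Theta,X^A_{1:t},Y_{1:t-1},X^B_{1:t})$; then, conditionally on everything up to time $t$ (that is, on $\Theta,X^A_{1:t},X^B_{1:t},Y_{1:t}$), $X^A_{t+1}$ is drawn from a given kernel $p(X^A_{t+1}\mid\Theta,X^A_t,X^B_t)$ and $X^B_{t+1}$ is drawn, conditionally independently, from a given kernel $p(X^B_{t+1}\mid X^B_t,Y_t)$. The resulting joint law is denoted $p^{\boldsymbol\pi}$, and $I^{\boldsymbol\pi}$, $\mathbb{E}^{\boldsymbol\pi}$ denote mutual information and expectation under it. Notation $Z_{1:t}=(Z_1,\dots,Z_t)$. Problem (P). Given a weight $\rho$, a cost function $r$, a distortion function $d$, and a bound $\hat D$, $$\min_{\boldsymbol{\pi}=\{\pi_t\}_{t=1}^T} L(\boldsymbol\pi):=\rho\, I^{\boldsymbol{\pi}}(\Theta;Y_{1:T},X^B_{1:T})+\sum_{t=1}^T\mathbb{E}^{\boldsymbol{\pi}}\big[r(\theta^*,X_t^A,X_{t+1}^A,Y_t)\big]$$ $$\text{s.t.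 } \mathbb{E}^{\pi_t}[d(X_t^A,Y_t)]\le\hat D,\quad t=1,\dots,T.$$ Here $\mathbb{E}^{\boldsymbol\pi}[r(\theta^*,X^A_t,X^A_{t+1},Y_t)]$ is the integral of $r(\theta^*,x,x',y)$ against the joint density $p^{\boldsymbol\pi}$ of $(\Theta,X^A_t,X^A_{t+1},Y_t)$ evaluated at $\Theta=\theta^*$, i.e. against $p^{\boldsymbol\pi}(\theta^*,x,x',y)\,dx\,dx'\,dy$. $\mathbb{E}^{\pi_t}[d(X_t^A,Y_t)]$ is the expectation of $d(X_t^A,Y_t)$ under $p^{\boldsymbol\pi}$. *)

theory Defs
  imports "HOL-Probability.Probability"
begin

section \<open>Densities and extended-real integrals\<close>

definition is_density :: "'t measure \<Rightarrow> ('t \<Rightarrow> real) \<Rightarrow> bool" where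
  "is_density N f \<longleftrightarrow>
     f \<in> borel_measurable N \<and> (\<forall>y\<in>space N. 0 \<le> f y) \<and> (\<integral>\<^sup>+y. ennreal (f y) \<partial>N) = 1"

definition density_kernel :: "'s measure \<Rightarrow> 't measure \<Rightarrow> ('s \<Rightarrow> 't \<Rightarrow> real) \<Rightarrow> bool" where
  "density_kernel M N k \<longleftrightarrow>
     (\<lambda>(x, y). k x y) \<in> borel_measurable (M \<Otimes>\<^sub>M N) \<and> (\<forall>x\<in>space M. is_density N (k x))"

text \<open>
  The library integral and mutual information are real-valued and return a default value when the
  integrand is not integrable. In a minimization problem such a default could make an ill-behaved
  policy look cheap, so both are extended to \<^typ>\<open>ereal\<close>. On \<^typ>\<open>ereal\<close> we have
  \<open>\<infinity> - \<infinity> = \<infinity>\<close>, so an undefined expectation violates every upper bound and is never preferred.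
\<close>

definition ereal_integral :: "'s measure \<Rightarrow> ('s \<Rightarrow> real) \<Rightarrow> ereal" where
  "ereal_integral M f =
     enn2ereal (\<integral>\<^sup>+x. ennreal (f x) \<partial>M) - enn2ereal (\<integral>\<^sup>+x. ennreal (- f x) \<partial>M)"

lemma ereal_integral_eq_integral:
  assumes "integrable M f"
  shows "ereal_integral M f = ereal (\<integral>x. f x \<partial>M)"
proof -
  have "(\<integral>\<^sup>+x. ennreal (f x) \<partial>M) < \<infinity>" "(\<integral>\<^sup>+x. ennreal (- f x) \<partial>M) < \<infinity>"
    using assms by (auto simp: real_integrable_def less_top)
  then show ?thesis
    unfolding ereal_integral_def real_lebesgue_integral_def[OF assms]
    by (cases "\<integral>\<^sup>+x. ennreal (f x) \<partial>M"; cases "\<integral>\<^sup>+x. ennreal (- f x) \<partial>M")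
      (auto simp: enn2ereal_ennreal)
qed

text \<open>
  The negative part of the integrand of a Kullback-Leibler divergence is always integrable, so
  non-integrability means that the divergence is infinite.
\<close>

definition ereal_mutual_information ::
    "'s measure \<Rightarrow> real \<Rightarrow> 'u measure \<Rightarrow> 'v measure \<Rightarrow> ('s \<Rightarrow> 'u) \<Rightarrow> ('s \<Rightarrow> 'v) \<Rightarrow> ereal" where
  "ereal_mutual_information M b S T X Y =
     (let P = distr M S X \<Otimes>\<^sub>M distr M T Y;
          Q = distr M (S \<Otimes>\<^sub>M T) (\<lambda>\<omega>. (X \<omega>, Y \<omega>))
      in if absolutely_continuous P Q \<and> integrable Q (entropy_density b P Q)
         then ereal (prob_space.mutual_information M b S T X Y) else \<infinity>)"


section \<open>The data-sharing problem\<close>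

text \<open>
  Densities are taken with respect to reference measures: Lebesgue measure for probability
  densities, counting measures for mass functions. The initial law is given by the prior density
  and the conditional density of the initial states, so that the prior density is a finite number
  at every parameter value.
\<close>

record ('p, 'a, 'b, 'y) data_sharing =
  horizon :: nat
  ref_param :: "'p measure"
  ref_A :: "'a measure"
  ref_B :: "'b measure"
  ref_Y :: "'y measure"
  prior :: "'p \<Rightarrow> real"
  init :: "'p \<Rightarrow> 'a \<times> 'b \<Rightarrow> real"
  ker_A :: "nat \<Rightarrow> 'p \<times> 'a \<times> 'b \<Rightarrow> 'a \<Rightarrow> real"
  ker_B :: "nat \<Rightarrow> 'b \<times> 'y \<Rightarrow> 'b \<Rightarrow> real"
  log_base :: real
  weight :: real
  true_param :: 'p
  cost :: "'p \<Rightarrow> 'a \<Rightarrow> 'a \<Rightarrow> 'y \<Rightarrow> real"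
  dist_fun :: "'a \<Rightarrow> 'y \<Rightarrow> real"
  dist_bound :: real

locale data_sharing_problem =
  fixes S :: "('p, real ^ 'na, real ^ 'nb, 'y) data_sharing"
  assumes sets_ref_A: "sets (ref_A S) = sets borel"
    and sets_ref_B: "sets (ref_B S) = sets borel"
    and sigma_finite_ref_param: "sigma_finite_measure (ref_param S)"
    and sigma_finite_ref_A: "sigma_finite_measure (ref_A S)"
    and sigma_finite_ref_B: "sigma_finite_measure (ref_B S)"
    and sigma_finite_ref_Y: "sigma_finite_measure (ref_Y S)"
    and prior: "is_density (ref_param S) (prior S)"
    and init: "density_kernel (ref_param S) (ref_A S \<Otimes>\<^sub>M ref_B S) (init S)"
    and ker_A: "\<And>t. t \<in> {1..horizon S} \<Longrightarrow>
      density_kernel (ref_param S \<Otimes>\<^sub>M ref_A S \<Otimes>\<^sub>M ref_B S) (ref_A S) (ker_A S t)"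
    and ker_B: "\<And>t. t \<in> {1..horizon S} \<Longrightarrow>
      density_kernel (ref_B S \<Otimes>\<^sub>M ref_Y S) (ref_B S) (ker_B S t)"
    and log_base: "1 < log_base S"
    and true_param: "true_param S \<in> space (ref_param S)"
    and measurable_cost: "(\<lambda>(\<theta>, x, x', y). cost S \<theta> x x' y)
      \<in> borel_measurable (ref_param S \<Otimes>\<^sub>M ref_A S \<Otimes>\<^sub>M ref_A S \<Otimes>\<^sub>M ref_Y S)"
    and measurable_dist_fun: "(\<lambda>(x, y). dist_fun S x y) \<in> borel_measurable (ref_A S \<Otimes>\<^sub>M ref_Y S)"

subsection \<open>Policies\<close>

text \<open>
  A trajectory \<open>Z\<^sub>1, \<dots>, Z\<^sub>t\<close> is an extensional function on \<open>{1..t}\<close>. The policy at time \<open>t\<close> takes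
  the parameter and the trajectories of \<open>A\<close> up to \<open>t\<close>, of the shared data up to \<open>t - 1\<close> and of
  \<open>B\<close> up to \<open>t\<close>, and returns a density of the data shared at time \<open>t\<close>.
\<close>

type_synonym ('p, 'a, 'b, 'y) policy =
  "nat \<Rightarrow> 'p \<times> (nat \<Rightarrow> 'a) \<times> (nat \<Rightarrow> 'y) \<times> (nat \<Rightarrow> 'b) \<Rightarrow> 'y \<Rightarrow> real"

type_synonym ('p, 'a, 'b, 'y) simplified_policy =
  "nat \<Rightarrow> 'p \<times> 'a \<times> (nat \<Rightarrow> 'b) \<times> (nat \<Rightarrow> 'y) \<Rightarrow> 'y \<Rightarrow> real"

definition policies :: "('p, 'a, 'b, 'y) data_sharing \<Rightarrow> ('p, 'a, 'b, 'y) policy set" where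
  "policies S = {\<pi>. \<forall>t\<in>{1..horizon S}. density_kernel
     (ref_param S \<Otimes>\<^sub>M PiM {1..t} (\<lambda>_. ref_A S) \<Otimes>\<^sub>M PiM {1..<t} (\<lambda>_. ref_Y S) \<Otimes>\<^sub>M
      PiM {1..t} (\<lambda>_. ref_B S))
     (ref_Y S) (\<pi> t)}"

definition as_policy :: "('p, 'a, 'b, 'y) simplified_policy \<Rightarrow> ('p, 'a, 'b, 'y) policy" where
  "as_policy \<sigma> = (\<lambda>t (\<theta>, xA, y, xB). \<sigma> t (\<theta>, xA t, xB, y))"

definition simplified_policies ::
    "('p, 'a, 'b, 'y) data_sharing \<Rightarrow> ('p, 'a, 'b, 'y) policy set" where
  "simplified_policies S = as_policy ` {\<sigma>. \<forall>t\<in>{1..horizon S}. density_kernel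
     (ref_param S \<Otimes>\<^sub>M ref_A S \<Otimes>\<^sub>M PiM {1..t} (\<lambda>_. ref_B S) \<Otimes>\<^sub>M PiM {1..<t} (\<lambda>_. ref_Y S))
     (ref_Y S) (\<sigma> t)}"

lemma simplified_policies_subset: "simplified_policies S \<subseteq> policies S"
proof
  fix \<pi> assume "\<pi> \<in> simplified_policies S"
  then obtain \<sigma> where \<pi>: "\<pi> = as_policy \<sigma>"
    and \<sigma>: "\<And>t. t \<in> {1..horizon S} \<Longrightarrow> density_kernel
     (ref_param S \<Otimes>\<^sub>M ref_A S \<Otimes>\<^sub>M PiM {1..t} (\<lambda>_. ref_B S) \<Otimes>\<^sub>M PiM {1..<t} (\<lambda>_. ref_Y S))
     (ref_Y S) (\<sigma> t)"
    by (auto simp: simplified_policies_def)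
  show "\<pi> \<in> policies S"
    unfolding policies_def mem_Collect_eq
  proof
    fix t assume t: "t \<in> {1..horizon S}"
    let ?H = "ref_param S \<Otimes>\<^sub>M PiM {1..t} (\<lambda>_. ref_A S) \<Otimes>\<^sub>M PiM {1..<t} (\<lambda>_. ref_Y S) \<Otimes>\<^sub>M
      PiM {1..t} (\<lambda>_. ref_B S)"
    let ?K = "ref_param S \<Otimes>\<^sub>M ref_A S \<Otimes>\<^sub>M PiM {1..t} (\<lambda>_. ref_B S) \<Otimes>\<^sub>M PiM {1..<t} (\<lambda>_. ref_Y S)"
    let ?g = "\<lambda>(\<theta>, xA, y, xB). (\<theta>, xA t, xB, y)"
    have comp [measurable]: "(\<lambda>xA. xA t) \<in> measurable (PiM {1..t} (\<lambda>_. ref_A S)) (ref_A S)"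
      using t by (intro measurable_component_singleton) auto
    have g [measurable]: "?g \<in> measurable ?H ?K"
      by measurable
    from \<sigma>[OF t] have [measurable]: "(\<lambda>(h, y). \<sigma> t h y) \<in> borel_measurable (?K \<Otimes>\<^sub>M ref_Y S)"
      by (simp add: density_kernel_def)
    have "(\<lambda>(h, y). \<sigma> t (?g h) y) = (\<lambda>(h, y). \<sigma> t h y) \<circ> (\<lambda>(h, y). (?g h, y))"
      by auto
    also have "\<dots> \<in> borel_measurable (?H \<Otimes>\<^sub>M ref_Y S)"
      by measurable
    finally have meas: "(\<lambda>(h, y). \<pi> t h y) \<in> borel_measurable (?H \<Otimes>\<^sub>M ref_Y S)"
      unfolding \<pi> as_policy_def by (simp add: case_prod_unfold)
    have "is_density (ref_Y S) (\<pi> t h)" if "h \<in> space ?H" for h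
    proof -
      have "is_density (ref_Y S) (\<sigma> t (?g h))"
        using \<sigma>[OF t] measurable_space[OF g that] unfolding density_kernel_def by blast
      then show ?thesis
        unfolding \<pi> as_policy_def by (simp add: case_prod_unfold)
    qed
    with meas show "density_kernel ?H (ref_Y S) (\<pi> t)"
      by (simp add: density_kernel_def)
  qed
qed

subsection \<open>The joint law\<close>

text \<open>
  The density at \<open>(\<theta>, x\<^sup>A\<^sub>1, \<dots>, x\<^sup>A\<^sub>T\<^sub>+\<^sub>1, x\<^sup>B\<^sub>1, \<dots>, x\<^sup>B\<^sub>T\<^sub>+\<^sub>1, y\<^sub>1, \<dots>, y\<^sub>T)\<close>, by the chain rule
  along the sampling order.
\<close>

definition joint_density ::
    "('p, 'a, 'b, 'y) data_sharing \<Rightarrow> ('p, 'a, 'b, 'y) policy \<Rightarrow>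
     'p \<Rightarrow> (nat \<Rightarrow> 'a) \<Rightarrow> (nat \<Rightarrow> 'b) \<Rightarrow> (nat \<Rightarrow> 'y) \<Rightarrow> real" where
  "joint_density S \<pi> \<theta> xA xB y =
     prior S \<theta> * init S \<theta> (xA 1, xB 1) *
     (\<Prod>t = 1..horizon S.
        \<pi> t (\<theta>, restrict xA {1..t}, restrict y {1..<t}, restrict xB {1..t}) (y t) *
        ker_A S t (\<theta>, xA t, xB t) (xA (t + 1)) *
        ker_B S t (xB t, y t) (xB (t + 1)))"

definition joint_law ::
    "('p, 'a, 'b, 'y) data_sharing \<Rightarrow> ('p, 'a, 'b, 'y) policy \<Rightarrow>
     ('p \<times> (nat \<Rightarrow> 'a) \<times> (nat \<Rightarrow> 'b) \<times> (nat \<Rightarrow> 'y)) measure" where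
  "joint_law S \<pi> = density
     (ref_param S \<Otimes>\<^sub>M PiM {1..horizon S + 1} (\<lambda>_. ref_A S) \<Otimes>\<^sub>M
      PiM {1..horizon S + 1} (\<lambda>_. ref_B S) \<Otimes>\<^sub>M PiM {1..horizon S} (\<lambda>_. ref_Y S))
     (\<lambda>(\<theta>, xA, xB, y). ennreal (joint_density S \<pi> \<theta> xA xB y))"

text \<open>
  The density of \<open>(\<Theta>, X\<^sup>A\<^sub>t, X\<^sup>A\<^sub>t\<^sub>+\<^sub>1, Y\<^sub>t)\<close>. It is evaluated pointwise in the parameter below, so
  the version matters: it is the one obtained by integrating out all other coordinates.
\<close>

definition transition_density ::
    "('p, 'a, 'b, 'y) data_sharing \<Rightarrow> ('p, 'a, 'b, 'y) policy \<Rightarrow> nat \<Rightarrow>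
     'p \<Rightarrow> 'a \<Rightarrow> 'a \<Rightarrow> 'y \<Rightarrow> ennreal" where
  "transition_density S \<pi> t \<theta> x x' y =
     (\<integral>\<^sup>+ xA. \<integral>\<^sup>+ xB. \<integral>\<^sup>+ ys.
        ennreal (joint_density S \<pi> \<theta> (xA(t := x, t + 1 := x')) xB (ys(t := y)))
        \<partial>PiM ({1..horizon S} - {t}) (\<lambda>_. ref_Y S)
        \<partial>PiM {1..horizon S + 1} (\<lambda>_. ref_B S)
        \<partial>PiM ({1..horizon S + 1} - {t, t + 1}) (\<lambda>_. ref_A S))"

subsection \<open>Objective, constraints and optimality\<close>

text \<open>\<open>I(\<Theta>; Y\<^sub>1, \<dots>, Y\<^sub>T, X\<^sup>B\<^sub>1, \<dots>, X\<^sup>B\<^sub>T)\<close>\<close>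

definition privacy_loss ::
    "('p, 'a, 'b, 'y) data_sharing \<Rightarrow> ('p, 'a, 'b, 'y) policy \<Rightarrow> ereal" where
  "privacy_loss S \<pi> = ereal_mutual_information (joint_law S \<pi>) (log_base S)
     (ref_param S)
     (PiM {1..horizon S} (\<lambda>_. ref_Y S) \<Otimes>\<^sub>M PiM {1..horizon S} (\<lambda>_. ref_B S))
     (\<lambda>(\<theta>, xA, xB, y). \<theta>)
     (\<lambda>(\<theta>, xA, xB, y). (y, restrict xB {1..horizon S}))"

definition expected_cost ::
    "('p, 'a, 'b, 'y) data_sharing \<Rightarrow> ('p, 'a, 'b, 'y) policy \<Rightarrow> nat \<Rightarrow> ereal" where
  "expected_cost S \<pi> t = ereal_integral
     (density (ref_A S \<Otimes>\<^sub>M ref_A S \<Otimes>\<^sub>M ref_Y S)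
        (\<lambda>(x, x', y). transition_density S \<pi> t (true_param S) x x' y))
     (\<lambda>(x, x', y). cost S (true_param S) x x' y)"

definition expected_distortion ::
    "('p, 'a, 'b, 'y) data_sharing \<Rightarrow> ('p, 'a, 'b, 'y) policy \<Rightarrow> nat \<Rightarrow> ereal" where
  "expected_distortion S \<pi> t =
     ereal_integral (joint_law S \<pi>) (\<lambda>(\<theta>, xA, xB, y). dist_fun S (xA t) (y t))"

definition objective ::
    "('p, 'a, 'b, 'y) data_sharing \<Rightarrow> ('p, 'a, 'b, 'y) policy \<Rightarrow> ereal" where
  "objective S \<pi> =
     ereal (weight S) * privacy_loss S \<pi> + (\<Sum>t = 1..horizon S. expected_cost S \<pi> t)"

definition feasible :: "('p, 'a, 'b, 'y) data_sharing \<Rightarrow> ('p, 'a, 'b, 'y) policy \<Rightarrow> bool" where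
  "feasible S \<pi> \<longleftrightarrow> \<pi> \<in> policies S \<and>
     (\<forall>t\<in>{1..horizon S}. expected_distortion S \<pi> t \<le> ereal (dist_bound S))"

definition optimal :: "('p, 'a, 'b, 'y) data_sharing \<Rightarrow> ('p, 'a, 'b, 'y) policy \<Rightarrow> bool" where
  "optimal S \<pi> \<longleftrightarrow> is_arg_min (objective S) (feasible S) \<pi>"

end

theory Submission
  imports Defs
begin

section \<open>Discarding the history of the data provider\<close>

text \<open>
  Given \<open>\<pi>\<close>, let \<open>\<sigma>\<^sub>t\<close> be the conditional law of \<open>Y\<^sub>t\<close> given \<open>(\<Theta>, X\<^sup>A\<^sub>t, X\<^sup>B\<^sub>1\<^sub>:\<^sub>t, Y\<^sub>1\<^sub>:\<^sub>t\<^sub>-\<^sub>1)\<close> under \<open>\<pi>\<close>. Since the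
  transition kernels see only the current states, induction on \<open>t\<close> shows that \<open>\<pi>\<close> and \<open>\<sigma>\<close> induce the
  same law of \<open>(\<Theta>, X\<^sup>A\<^sub>t, X\<^sup>A\<^sub>t\<^sub>+\<^sub>1, X\<^sup>B\<^sub>1\<^sub>:\<^sub>t\<^sub>+\<^sub>1, Y\<^sub>1\<^sub>:\<^sub>t)\<close> for every \<open>t\<close>. The costs, the distortions and the mutual
  information are functionals of these laws. As the cost evaluates a density at the single
  point \<open>\<theta>\<^sup>*\<close>, the induction is carried out at each fixed parameter value and not merely almost
  everywhere.
\<close>

text \<open>The laws of the whole trajectory can differ: a policy that looks at an old state of
  \<open>A\<close> correlates that state with \<open>Y_t\<close>, and the conditional policy loses
  this correlation. So the densities of the histories cannot be compared directly. The induction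
  instead compares integrals of arbitrary nonnegative test functions of
  \<open>(xA t, xB, y)\<close>, with the older states of \<open>A\<close> integrated out by Tonelli.
  Nonnegative integrals need no integrability conditions; signed costs and distortions are split
  into positive and negative parts only at the end.

  Each step in time makes two exchanges. The last policy is replaced while the law of the history
  stays that of \<open>\<pi>\<close>; this is the defining property of a conditional law. Then the
  law of the history is replaced, by the induction hypothesis.

  A conditional law is a quotient of densities, yet a policy must be a density at every argument. A
  zero denominator is harmless because the numerator then vanishes almost everywhere. An infinite
  one occurs only on a null set, because all kernels are normalised everywhere and so the history
  has mass \<open>1\<close> at each fixed \<open>\<theta>\<close>.\<close>

declare One_nat_def [simp del]

subsection \<open>Product measures\<close>

lemma measurable_fun_upd_insert [measurable (raw)]:
  assumes "f \<in> measurable N (PiM I M)" "h \<in> measurable N (M i)"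
  shows "(\<lambda>x. (f x)(i := h x)) \<in> measurable N (PiM (insert i I) M)"
  using assms by (intro measurable_fun_upd[where J = I]) auto

text \<open>Tonelli moves the integral over the split-off coordinate past \<open>N\<close>, to the
  innermost place. The index set is a variable \<open>J\<close> with an equation because an interval
  such as \<open>{1..Suc t}\<close> is not syntactically an insertion.\<close>

lemma (in product_sigma_finite) nn_integral_PiM_insert_pair_fst:
  assumes "finite I" "i \<notin> I" and J: "J = insert i I" and "sigma_finite_measure N"
    and f: "f \<in> borel_measurable (PiM J M \<Otimes>\<^sub>M N)"
  shows "(\<integral>\<^sup>+z. f z \<partial>(PiM J M \<Otimes>\<^sub>M N)) =
    (\<integral>\<^sup>+z. \<integral>\<^sup>+x. f ((fst z)(i := x), snd z) \<partial>M i \<partial>(PiM I M \<Otimes>\<^sub>M N))"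
proof -
  interpret N: sigma_finite_measure N by fact
  note [measurable] = f[unfolded J]
  interpret I: sigma_finite_measure "PiM I M" by (rule sigma_finite) fact
  interpret Mi: pair_sigma_finite "M i" N by unfold_locales
  have "(\<integral>\<^sup>+z. f z \<partial>(PiM J M \<Otimes>\<^sub>M N)) =
      (\<integral>\<^sup>+p. \<integral>\<^sup>+q. f (p, q) \<partial>N \<partial>PiM (insert i I) M)"
    unfolding J by (simp add: N.nn_integral_fst)
  also have "\<dots> = (\<integral>\<^sup>+p. \<integral>\<^sup>+x. \<integral>\<^sup>+q. f (p(i := x), q) \<partial>N \<partial>M i \<partial>PiM I M)"
    by (intro product_nn_integral_insert assms) simp
  also have "\<dots> = (\<integral>\<^sup>+p. \<integral>\<^sup>+q. \<integral>\<^sup>+x. f (p(i := x), q) \<partial>M i \<partial>N \<partial>PiM I M)"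
    by (intro nn_integral_cong Mi.Fubini'[symmetric]) measurable
  also have "\<dots> = (\<integral>\<^sup>+z. \<integral>\<^sup>+x. f ((fst z)(i := x), snd z) \<partial>M i \<partial>(PiM I M \<Otimes>\<^sub>M N))"
    by (subst N.nn_integral_fst[symmetric]) measurable
  finally show ?thesis .
qed

lemma (in product_sigma_finite) nn_integral_PiM_insert_pair_snd:
  assumes "finite I" "i \<notin> I" and J: "J = insert i I" and "sigma_finite_measure N"
    and f: "f \<in> borel_measurable (N \<Otimes>\<^sub>M PiM J M)"
  shows "(\<integral>\<^sup>+z. f z \<partial>(N \<Otimes>\<^sub>M PiM J M)) =
    (\<integral>\<^sup>+z. \<integral>\<^sup>+x. f (fst z, (snd z)(i := x)) \<partial>M i \<partial>(N \<Otimes>\<^sub>M PiM I M))"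
proof -
  interpret I: sigma_finite_measure "PiM I M" by (rule sigma_finite) fact
  interpret I': sigma_finite_measure "PiM (insert i I) M" by (rule sigma_finite) (use assms in simp)
  note [measurable] = f[unfolded J]
  have "(\<integral>\<^sup>+z. f z \<partial>(N \<Otimes>\<^sub>M PiM J M)) =
      (\<integral>\<^sup>+q. \<integral>\<^sup>+p. f (q, p) \<partial>PiM (insert i I) M \<partial>N)"
    unfolding J by (simp add: I'.nn_integral_fst)
  also have "\<dots> = (\<integral>\<^sup>+q. \<integral>\<^sup>+p. \<integral>\<^sup>+x. f (q, p(i := x)) \<partial>M i \<partial>PiM I M \<partial>N)"
    by (intro nn_integral_cong product_nn_integral_insert assms) simp
  also have "\<dots> = (\<integral>\<^sup>+z. \<integral>\<^sup>+x. f (fst z, (snd z)(i := x)) \<partial>M i \<partial>(N \<Otimes>\<^sub>M PiM I M))"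
    by (subst I.nn_integral_fst[symmetric]) measurable
  finally show ?thesis .
qed

text \<open>Serves as a \<open>measurable (raw)\<close> rule: the hypotheses speak of uncurried
  functions on product spaces, the goals of curried applications.\<close>

lemma measurable_curry2:
  assumes "(\<lambda>(a, b). g a b) \<in> measurable (M1 \<Otimes>\<^sub>M M2) N" "f \<in> measurable L M1" "h \<in> measurable L M2"
  shows "(\<lambda>w. g (f w) (h w)) \<in> measurable L N"
  using measurable_compose[OF measurable_Pair[OF assms(2,3)] assms(1)] by simp

lemma measurable_curry3:
  assumes "(\<lambda>(a, b, c). g a b c) \<in> measurable (M1 \<Otimes>\<^sub>M M2 \<Otimes>\<^sub>M M3) N"
    and "f \<in> measurable L M1" "h \<in> measurable L M2" "k \<in> measurable L M3"
  shows "(\<lambda>w. g (f w) (h w) (k w)) \<in> measurable L N"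
  using measurable_compose[OF measurable_Pair[OF assms(2) measurable_Pair[OF assms(3,4)]] assms(1)]
  by simp

lemma restrict_space_PiM: "x \<in> space (PiM I M) \<Longrightarrow> restrict x I = x"
  by (auto simp: space_PiM PiE_def extensional_restrict)

lemma density_kernel_measurable:
  assumes "density_kernel M N k" "f \<in> measurable L M" "g \<in> measurable L N"
  shows "(\<lambda>w. k (f w) (g w)) \<in> borel_measurable L"
  using measurable_compose[OF measurable_Pair[OF assms(2,3)], of "\<lambda>(x, y). k x y" borel] assms(1)
  by (simp add: density_kernel_def)

lemma density_kernel_nonneg:
  "density_kernel M N k \<Longrightarrow> x \<in> space M \<Longrightarrow> y \<in> space N \<Longrightarrow> 0 \<le> k x y"
  by (simp add: density_kernel_def is_density_def)

lemma density_kernel_integral: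
  "density_kernel M N k \<Longrightarrow> x \<in> space M \<Longrightarrow> (\<integral>\<^sup>+y. ennreal (k x y) \<partial>N) = 1"
  by (simp add: density_kernel_def is_density_def)

text \<open>This rule and the next two restate the update rule for the intervals that occur as index
  sets. States are extended at \<open>Suc t\<close> and shared data at \<open>t\<close>; the version
  ending in \<open>{1..t}\<close> reattaches the current state of \<open>A\<close> to its
  past.\<close>

lemma measurable_fun_upd_Suc [measurable (raw)]:
  assumes "f \<in> measurable N (PiM {1..t} (\<lambda>_. M))" "h \<in> measurable N M"
  shows "(\<lambda>x. (f x)(Suc t := h x)) \<in> measurable N (PiM {1..Suc t} (\<lambda>_. M))"
  using assms by (intro measurable_fun_upd[where J = "{1..t}"]) auto

lemma measurable_fun_upd_less_Suc [measurable (raw)]: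
  assumes "1 \<le> (t::nat)" "f \<in> measurable N (PiM {1..<t} (\<lambda>_. M))" "h \<in> measurable N M"
  shows "(\<lambda>x. (f x)(t := h x)) \<in> measurable N (PiM {1..<Suc t} (\<lambda>_. M))"
  using assms by (intro measurable_fun_upd[where J = "{1..<t}"]) auto

lemma measurable_fun_upd_less [measurable (raw)]:
  assumes "1 \<le> (t::nat)" "f \<in> measurable N (PiM {1..<t} (\<lambda>_. M))" "h \<in> measurable N M"
  shows "(\<lambda>x. (f x)(t := h x)) \<in> measurable N (PiM {1..t} (\<lambda>_. M))"
  using assms by (intro measurable_fun_upd[where J = "{1..<t}"]) auto

subsection \<open>Expectations of functions of the history\<close>

sublocale data_sharing_problem \<subseteq> P: sigma_finite_measure "ref_param S"
  by (rule sigma_finite_ref_param)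

sublocale data_sharing_problem \<subseteq> A: product_sigma_finite "\<lambda>_::nat. ref_A S"
  by (simp add: product_sigma_finite_def sigma_finite_ref_A)

sublocale data_sharing_problem \<subseteq> B: product_sigma_finite "\<lambda>_::nat. ref_B S"
  by (simp add: product_sigma_finite_def sigma_finite_ref_B)

sublocale data_sharing_problem \<subseteq> Y: product_sigma_finite "\<lambda>_::nat. ref_Y S"
  by (simp add: product_sigma_finite_def sigma_finite_ref_Y)

context data_sharing_problem
begin

abbreviation "PA I \<equiv> PiM I (\<lambda>_::nat. ref_A S)"
abbreviation "PB I \<equiv> PiM I (\<lambda>_::nat. ref_B S)"
abbreviation "PY I \<equiv> PiM I (\<lambda>_::nat. ref_Y S)"
text \<open>The trajectories known when \<open>Y_t\<close> is about to be drawn, hence the half-open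
  interval for the shared data. The trajectories of the full problem are those at
  \<open>Suc (horizon S)\<close>.\<close>

abbreviation "traj t \<equiv> PA {1..t} \<Otimes>\<^sub>M PB {1..t} \<Otimes>\<^sub>M PY {1..<t}"

section \<open>Tonelli on the spaces of trajectories\<close>

lemma sigma_finite_PA: "finite I \<Longrightarrow> sigma_finite_measure (PA I)"
  and sigma_finite_PB: "finite I \<Longrightarrow> sigma_finite_measure (PB I)"
  and sigma_finite_PY: "finite I \<Longrightarrow> sigma_finite_measure (PY I)"
  by (rule A.sigma_finite B.sigma_finite Y.sigma_finite; assumption)+

lemma sigma_finite_PB_PY:
  "finite I \<Longrightarrow> finite J \<Longrightarrow> sigma_finite_measure (PB I \<Otimes>\<^sub>M PY J)"
  by (simp add: pair_sigma_finite.intro sigma_finite_PB sigma_finite_PY sigma_finite_pair_measure)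

text \<open>Three coordinates are peeled off one after the other. The nesting is chosen for the
  sampling order: the kernel of \<open>B\<close> needs \<open>y'\<close>, so the shared data are
  integrated outermost.\<close>

lemma nn_integral_traj_Suc:
  assumes t: "1 \<le> t" and f [measurable]: "f \<in> borel_measurable (traj (Suc t))"
  shows "(\<integral>\<^sup>+h. f h \<partial>traj (Suc t)) = (\<integral>\<^sup>+h. (case h of (xA, xB, y) \<Rightarrow>
    \<integral>\<^sup>+y'. \<integral>\<^sup>+b. \<integral>\<^sup>+x. f (xA(Suc t := x), xB(Suc t := b), y(t := y')) \<partial>ref_A S \<partial>ref_B S \<partial>ref_Y S) \<partial>traj t)"
proof -
  interpret BY': sigma_finite_measure "PB {1..Suc t} \<Otimes>\<^sub>M PY {1..<Suc t}"
    by (simp add: sigma_finite_PB_PY)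
  interpret BY: sigma_finite_measure "PB {1..t} \<Otimes>\<^sub>M PY {1..<t}"
    by (simp add: sigma_finite_PB_PY)
  have eA: "{1..Suc t} = insert (Suc t) {1..t}" and eY: "{1..<Suc t} = insert t {1..<t}"
    using t by auto
  have "(\<integral>\<^sup>+h. f h \<partial>traj (Suc t)) =
      (\<integral>\<^sup>+z. \<integral>\<^sup>+x. f ((fst z)(Suc t := x), snd z) \<partial>ref_A S
        \<partial>(PA {1..t} \<Otimes>\<^sub>M PB {1..Suc t} \<Otimes>\<^sub>M PY {1..<Suc t}))"
    by (intro A.nn_integral_PiM_insert_pair_fst eA BY'.sigma_finite_measure_axioms f) auto
  also have "\<dots> = (\<integral>\<^sup>+xA. \<integral>\<^sup>+q. \<integral>\<^sup>+x. f (xA(Suc t := x), q) \<partial>ref_A S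
        \<partial>(PB {1..Suc t} \<Otimes>\<^sub>M PY {1..<Suc t}) \<partial>PA {1..t})"
    by (subst BY'.nn_integral_fst[symmetric]) measurable
  also have "\<dots> = (\<integral>\<^sup>+xA. \<integral>\<^sup>+q. \<integral>\<^sup>+y'. \<integral>\<^sup>+b. \<integral>\<^sup>+x. f (xA(Suc t := x), (fst q)(Suc t := b), (snd q)(t := y')) \<partial>ref_A S
        \<partial>ref_B S \<partial>ref_Y S \<partial>(PB {1..t} \<Otimes>\<^sub>M PY {1..<t}) \<partial>PA {1..t})"
  proof (rule nn_integral_cong)
    fix xA assume [measurable]: "xA \<in> space (PA {1..t})"
    define F where "F q = (\<integral>\<^sup>+x. f (xA(Suc t := x), q) \<partial>ref_A S)" for q
    have F [measurable]: "F \<in> borel_measurable (PB {1..Suc t} \<Otimes>\<^sub>M PY {1..<Suc t})"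
      unfolding F_def by measurable
    have "(\<integral>\<^sup>+q. F q \<partial>(PB {1..Suc t} \<Otimes>\<^sub>M PY {1..<Suc t})) =
        (\<integral>\<^sup>+q. \<integral>\<^sup>+b. F ((fst q)(Suc t := b), snd q) \<partial>ref_B S \<partial>(PB {1..t} \<Otimes>\<^sub>M PY {1..<Suc t}))"
      by (intro B.nn_integral_PiM_insert_pair_fst eA sigma_finite_PY F) auto
    also have "\<dots> = (\<integral>\<^sup>+q. \<integral>\<^sup>+y'. \<integral>\<^sup>+b. F ((fst q)(Suc t := b), (snd q)(t := y')) \<partial>ref_B S \<partial>ref_Y S \<partial>(PB {1..t} \<Otimes>\<^sub>M PY {1..<t}))"
      by (subst Y.nn_integral_PiM_insert_pair_snd[OF _ _ eY]) (auto simp: sigma_finite_PB)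
    finally show "(\<integral>\<^sup>+q. \<integral>\<^sup>+x. f (xA(Suc t := x), q) \<partial>ref_A S \<partial>(PB {1..Suc t} \<Otimes>\<^sub>M PY {1..<Suc t})) =
       (\<integral>\<^sup>+q. \<integral>\<^sup>+y'. \<integral>\<^sup>+b. \<integral>\<^sup>+x. f (xA(Suc t := x), (fst q)(Suc t := b), (snd q)(t := y')) \<partial>ref_A S
        \<partial>ref_B S \<partial>ref_Y S \<partial>(PB {1..t} \<Otimes>\<^sub>M PY {1..<t}))"
      unfolding F_def .
  qed
  also have "\<dots> = (\<integral>\<^sup>+h. (case h of (xA, xB, y) \<Rightarrow>
    \<integral>\<^sup>+y'. \<integral>\<^sup>+b. \<integral>\<^sup>+x. f (xA(Suc t := x), xB(Suc t := b), y(t := y')) \<partial>ref_A S \<partial>ref_B S \<partial>ref_Y S) \<partial>traj t)"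
    unfolding case_prod_unfold
    using t by (subst BY.nn_integral_fst[symmetric]) measurable
  finally show ?thesis .
qed

text \<open>Opposite nesting to the one-step splitting: the past of \<open>A\<close> goes innermost,
  so that it can be integrated out while everything the simplified policy conditions on is held
  fixed.\<close>

lemma nn_integral_traj_disintegrate:
  assumes t: "1 \<le> t" and f [measurable]: "f \<in> borel_measurable (traj t)"
  shows "(\<integral>\<^sup>+h. f h \<partial>traj t) = (\<integral>\<^sup>+z. (case z of (x, xB, y) \<Rightarrow>
    \<integral>\<^sup>+r. f (r(t := x), xB, y) \<partial>PA {1..<t}) \<partial>(ref_A S \<Otimes>\<^sub>M PB {1..t} \<Otimes>\<^sub>M PY {1..<t}))"
proof -
  let ?N = "PB {1..t} \<Otimes>\<^sub>M PY {1..<t}"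
  interpret N: sigma_finite_measure ?N
    by (simp add: sigma_finite_PB_PY)
  interpret R: sigma_finite_measure "PA {1..<t}"
    by (simp add: sigma_finite_PA)
  have eA: "{1..t} = insert t {1..<t}"
    using t by auto
  have m: "(\<lambda>p. \<integral>\<^sup>+q. f (p, q) \<partial>?N) \<in> borel_measurable (PA {1..t})"
    by measurable
  have "(\<integral>\<^sup>+h. f h \<partial>traj t) = (\<integral>\<^sup>+p. \<integral>\<^sup>+q. f (p, q) \<partial>?N \<partial>PA {1..t})"
    by (simp add: N.nn_integral_fst del: One_nat_def)
  also have "\<dots> = (\<integral>\<^sup>+x. \<integral>\<^sup>+r. \<integral>\<^sup>+q. f (r(t := x), q) \<partial>?N \<partial>PA {1..<t} \<partial>ref_A S)"
    using A.product_nn_integral_insert_rev[of "{1..<t}" t, OF _ _ m[unfolded eA]]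
    by (simp flip: eA)
  also have "\<dots> = (\<integral>\<^sup>+x. \<integral>\<^sup>+q. \<integral>\<^sup>+r. f (r(t := x), q) \<partial>PA {1..<t} \<partial>?N \<partial>ref_A S)"
    using t by (intro nn_integral_cong pair_sigma_finite.Fubini' pair_sigma_finite.intro
      N.sigma_finite_measure_axioms R.sigma_finite_measure_axioms) measurable
  also have "\<dots> = (\<integral>\<^sup>+z. (case z of (x, xB, y) \<Rightarrow>
    \<integral>\<^sup>+r. f (r(t := x), xB, y) \<partial>PA {1..<t}) \<partial>(ref_A S \<Otimes>\<^sub>M ?N))"
    unfolding case_prod_unfold
    using t by (subst N.nn_integral_fst[symmetric]) measurable
  finally show ?thesis .
qed

text \<open>Each factor is embedded into \<open>ennreal\<close> separately, so that products can be
  rearranged without sign conditions. The restrictions are those of \<open>joint_density\<close>: a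
  policy expects extensional trajectories of the right length.\<close>

definition step_density where
  "step_density \<pi> t \<theta> xA xB y =
     ennreal (\<pi> t (\<theta>, restrict xA {1..t}, restrict y {1..<t}, restrict xB {1..t}) (y t)) *
     ennreal (ker_A S t (\<theta>, xA t, xB t) (xA (Suc t))) *
     ennreal (ker_B S t (xB t, y t) (xB (Suc t)))"

text \<open>The prior is left out, so that the total mass is \<open>1\<close> at every \<open>\<theta>\<close>, also where the prior density vanishes.\<close>

definition history_density where
  "history_density \<pi> t \<theta> xA xB y =
     ennreal (init S \<theta> (xA 1, xB 1)) * (\<Prod>s = 1..<t. step_density \<pi> s \<theta> xA xB y)"

text \<open>The expectation given \<open>\<Theta> = \<theta>\<close>, in a version defined at every
  \<open>\<theta>\<close> and not just almost everywhere.\<close>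

definition expect where
  "expect \<pi> t \<theta> g = (\<integral>\<^sup>+(xA, xB, y). history_density \<pi> t \<theta> xA xB y * g xA xB y \<partial>traj t)"

section \<open>Chain rule and marginalisation\<close>

lemma history_density_Suc:
  "1 \<le> t \<Longrightarrow> history_density \<pi> (Suc t) \<theta> xA xB y =
    history_density \<pi> t \<theta> xA xB y * step_density \<pi> t \<theta> xA xB y"
  by (simp add: history_density_def mult.assoc)

text \<open>Steps before \<open>t\<close> read states up to time \<open>t\<close> and shared data up
  to \<open>t - 1\<close>, so coordinates appended later are invisible to them.\<close>

lemma history_density_upd:
  assumes "1 \<le> t"
  shows "history_density \<pi> t \<theta> (xA(Suc t := x)) (xB(Suc t := b)) (y(t := y')) =
    history_density \<pi> t \<theta> xA xB y"
proof -
  have "restrict (xA(Suc t := x)) {1..s} = restrict xA {1..s}"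
       "restrict (xB(Suc t := b)) {1..s} = restrict xB {1..s}"
       "restrict (y(t := y')) {1..<s} = restrict y {1..<s}" if "s < t" for s
    using that by (auto simp: fun_eq_iff restrict_def)
  then show ?thesis
    using assms by (auto simp: history_density_def step_density_def intro!: arg_cong2[where f = "(*)"] prod.cong)
qed

lemma policy_kernel:
  "\<pi> \<in> policies S \<Longrightarrow> t \<in> {1..horizon S} \<Longrightarrow>
    density_kernel (ref_param S \<Otimes>\<^sub>M PA {1..t} \<Otimes>\<^sub>M PY {1..<t} \<Otimes>\<^sub>M PB {1..t}) (ref_Y S) (\<pi> t)"
  by (simp add: policies_def)

lemma measurable_step_density:
  assumes "\<pi> \<in> policies S" and t: "1 \<le> t" "t < s" "s \<le> Suc (horizon S)"
    and [measurable]: "f \<in> measurable N (ref_param S)" "a \<in> measurable N (PA {1..s})"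
      "b \<in> measurable N (PB {1..s})" "y \<in> measurable N (PY {1..<s})"
  shows "(\<lambda>w. step_density \<pi> t (f w) (a w) (b w) (y w)) \<in> borel_measurable N"
proof -
  have t': "t \<in> {1..horizon S}"
    using t by auto
  note [measurable (raw)] = density_kernel_measurable[OF ker_A[OF t']]
    density_kernel_measurable[OF ker_B[OF t']] density_kernel_measurable[OF policy_kernel[OF assms(1) t']]
  have [measurable]: "(\<lambda>w. restrict (a w) {1..t}) \<in> measurable N (PA {1..t})"
    "(\<lambda>w. restrict (b w) {1..t}) \<in> measurable N (PB {1..t})"
    "(\<lambda>w. restrict (y w) {1..<t}) \<in> measurable N (PY {1..<t})"
    using t by (auto intro!: measurable_restrict)
  have [measurable]: "(\<lambda>w. a w t) \<in> measurable N (ref_A S)" "(\<lambda>w. a w (Suc t)) \<in> measurable N (ref_A S)"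
    "(\<lambda>w. b w t) \<in> measurable N (ref_B S)" "(\<lambda>w. b w (Suc t)) \<in> measurable N (ref_B S)"
    "(\<lambda>w. y w t) \<in> measurable N (ref_Y S)"
    using t by auto
  show ?thesis
    unfolding step_density_def by measurable
qed

lemma measurable_history_density:
  assumes "\<pi> \<in> policies S" and t: "1 \<le> t" "t \<le> Suc (horizon S)"
    and [measurable]: "f \<in> measurable N (ref_param S)" "a \<in> measurable N (PA {1..t})"
      "b \<in> measurable N (PB {1..t})" "y \<in> measurable N (PY {1..<t})"
  shows "(\<lambda>w. history_density \<pi> t (f w) (a w) (b w) (y w)) \<in> borel_measurable N"
proof -
  note [measurable (raw)] = density_kernel_measurable[OF init]
  have [measurable]: "(\<lambda>w. a w 1) \<in> measurable N (ref_A S)" "(\<lambda>w. b w 1) \<in> measurable N (ref_B S)"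
    using t by auto
  have [measurable]: "(\<lambda>w. step_density \<pi> s (f w) (a w) (b w) (y w)) \<in> borel_measurable N"
    if "s \<in> {1..<t}" for s
    using that t by (intro measurable_step_density[where s = t] assms) auto
  show ?thesis
    unfolding history_density_def by measurable
qed

text \<open>One step of the chain rule: the density of the old history does not see the new
  coordinates and leaves the three inner integrals as a constant factor.\<close>

lemma expect_Suc:
  fixes g :: "(nat \<Rightarrow> real ^ 'na) \<Rightarrow> (nat \<Rightarrow> real ^ 'nb) \<Rightarrow> (nat \<Rightarrow> 'y) \<Rightarrow> ennreal"
  assumes \<pi>: "\<pi> \<in> policies S" and \<theta>: "\<theta> \<in> space (ref_param S)" and t: "t \<in> {1..horizon S}"
    and g: "(\<lambda>(xA, xB, y). g xA xB y) \<in> borel_measurable (traj (Suc t))"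
  shows "expect \<pi> (Suc t) \<theta> g = expect \<pi> t \<theta> (\<lambda>xA xB y. \<integral>\<^sup>+y'. ennreal (\<pi> t (\<theta>, xA, y, xB) y') *
    (\<integral>\<^sup>+b. ennreal (ker_B S t (xB t, y') b) * (\<integral>\<^sup>+x. ennreal (ker_A S t (\<theta>, xA t, xB t) x) *
      g (xA(Suc t := x)) (xB(Suc t := b)) (y(t := y')) \<partial>ref_A S) \<partial>ref_B S) \<partial>ref_Y S)"
proof -
  note [measurable (raw)] = density_kernel_measurable[OF ker_A[OF t]]
    density_kernel_measurable[OF ker_B[OF t]] density_kernel_measurable[OF policy_kernel[OF \<pi> t]]
    measurable_history_density[OF \<pi>] measurable_curry3[OF g]
  have t1: "1 \<le> t" "1 \<le> Suc t" "t \<le> Suc (horizon S)" "Suc t \<le> Suc (horizon S)" "Suc t \<noteq> 1"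
    using t by auto
  note [measurable] = \<theta>
  \<comment> \<open>Points of a product space are extensional, so restricting an appended trajectory
    gives back the old one exactly.\<close>
  have [simp]: "restrict (xA(Suc t := x)) {1..t} = xA" "restrict (xB(Suc t := b)) {1..t} = xB"
    "restrict (y(t := y')) {1..<t} = y"
    if "xA \<in> space (PA {1..t})" "xB \<in> space (PB {1..t})" "y \<in> space (PY {1..<t})" for xA x xB b y y'
    using that by (auto simp: fun_eq_iff restrict_def space_PiM PiE_def extensional_def)
  have "(\<lambda>(xA, xB, y). history_density \<pi> (Suc t) \<theta> xA xB y * g xA xB y) \<in> borel_measurable (traj (Suc t))"
    using t1 by measurable
  then have "expect \<pi> (Suc t) \<theta> g = (\<integral>\<^sup>+(xA, xB, y). \<integral>\<^sup>+y'. \<integral>\<^sup>+b. \<integral>\<^sup>+x.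
      history_density \<pi> (Suc t) \<theta> (xA(Suc t := x)) (xB(Suc t := b)) (y(t := y')) *
      g (xA(Suc t := x)) (xB(Suc t := b)) (y(t := y')) \<partial>ref_A S \<partial>ref_B S \<partial>ref_Y S \<partial>traj t)"
    using t1 unfolding expect_def by (subst nn_integral_traj_Suc) auto
  also have "\<dots> = expect \<pi> t \<theta> (\<lambda>xA xB y. \<integral>\<^sup>+y'. ennreal (\<pi> t (\<theta>, xA, y, xB) y') *
    (\<integral>\<^sup>+b. ennreal (ker_B S t (xB t, y') b) * (\<integral>\<^sup>+x. ennreal (ker_A S t (\<theta>, xA t, xB t) x) *
      g (xA(Suc t := x)) (xB(Suc t := b)) (y(t := y')) \<partial>ref_A S) \<partial>ref_B S) \<partial>ref_Y S)"
    unfolding expect_def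
  proof (intro nn_integral_cong, clarsimp simp: space_pair_measure)
    fix xA xB y
    assume sp [measurable]: "xA \<in> space (PA {1..t})" "xB \<in> space (PB {1..t})" "y \<in> space (PY {1..<t})"
    have [measurable]: "xA t \<in> space (ref_A S)" "xB t \<in> space (ref_B S)"
      using sp t by (auto simp: space_PiM)
    let ?c = "history_density \<pi> t \<theta> xA xB y"
    have "(\<integral>\<^sup>+y'. \<integral>\<^sup>+b. \<integral>\<^sup>+x.
      history_density \<pi> (Suc t) \<theta> (xA(Suc t := x)) (xB(Suc t := b)) (y(t := y')) *
      g (xA(Suc t := x)) (xB(Suc t := b)) (y(t := y')) \<partial>ref_A S \<partial>ref_B S \<partial>ref_Y S) =
      (\<integral>\<^sup>+y'. \<integral>\<^sup>+b. \<integral>\<^sup>+x. ?c * (ennreal (\<pi> t (\<theta>, xA, y, xB) y') * (ennreal (ker_B S t (xB t, y') b) *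
        (ennreal (ker_A S t (\<theta>, xA t, xB t) x) *
      g (xA(Suc t := x)) (xB(Suc t := b)) (y(t := y'))))) \<partial>ref_A S \<partial>ref_B S \<partial>ref_Y S)"
      using t1 sp by (simp add: history_density_Suc history_density_upd step_density_def mult_ac restrict_space_PiM)
    also have "\<dots> = ?c * (\<integral>\<^sup>+y'. ennreal (\<pi> t (\<theta>, xA, y, xB) y') *
      (\<integral>\<^sup>+b. ennreal (ker_B S t (xB t, y') b) * (\<integral>\<^sup>+x. ennreal (ker_A S t (\<theta>, xA t, xB t) x) *
      g (xA(Suc t := x)) (xB(Suc t := b)) (y(t := y')) \<partial>ref_A S) \<partial>ref_B S) \<partial>ref_Y S)"
      using t1 by (simp add: nn_integral_cmult cong: nn_integral_cong_simp)
    finally show "(\<integral>\<^sup>+y'. \<integral>\<^sup>+b. \<integral>\<^sup>+x.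
      history_density \<pi> (Suc t) \<theta> (xA(Suc t := x)) (xB(Suc t := b)) (y(t := y')) *
      g (xA(Suc t := x)) (xB(Suc t := b)) (y(t := y')) \<partial>ref_A S \<partial>ref_B S \<partial>ref_Y S) =
      ?c * (\<integral>\<^sup>+y'. ennreal (\<pi> t (\<theta>, xA, y, xB) y') *
      (\<integral>\<^sup>+b. ennreal (ker_B S t (xB t, y') b) * (\<integral>\<^sup>+x. ennreal (ker_A S t (\<theta>, xA t, xB t) x) *
      g (xA(Suc t := x)) (xB(Suc t := b)) (y(t := y')) \<partial>ref_A S) \<partial>ref_B S) \<partial>ref_Y S)" .
  qed
  finally show ?thesis .
qed

lemma expect_cong:
  assumes "\<And>xA xB y. xA \<in> space (PA {1..t}) \<Longrightarrow> xB \<in> space (PB {1..t}) \<Longrightarrow> y \<in> space (PY {1..<t}) \<Longrightarrow>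
    f xA xB y = g xA xB y"
  shows "expect \<pi> t \<theta> f = expect \<pi> t \<theta> g"
  unfolding expect_def by (intro nn_integral_cong) (auto simp: space_pair_measure assms)

text \<open>Consistency in time: the integrand ignores the new coordinates, so the kernels of
  \<open>A\<close> and \<open>B\<close> and the policy integrate to \<open>1\<close>, from the
  inside out.\<close>

lemma expect_marginal:
  fixes g :: "(nat \<Rightarrow> real ^ 'na) \<Rightarrow> (nat \<Rightarrow> real ^ 'nb) \<Rightarrow> (nat \<Rightarrow> 'y) \<Rightarrow> ennreal"
  assumes \<pi>: "\<pi> \<in> policies S" and \<theta>: "\<theta> \<in> space (ref_param S)" and t: "t \<in> {1..horizon S}"
    and g: "(\<lambda>(xA, xB, y). g xA xB y) \<in> borel_measurable (traj t)"
  shows "expect \<pi> (Suc t) \<theta> (\<lambda>xA xB y. g (restrict xA {1..t}) (restrict xB {1..t}) (restrict y {1..<t})) =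
    expect \<pi> t \<theta> g"
proof -
  note [measurable (raw)] = density_kernel_measurable[OF ker_A[OF t]]
    density_kernel_measurable[OF ker_B[OF t]] density_kernel_measurable[OF policy_kernel[OF \<pi> t]]
    measurable_curry3[OF g]
  have [measurable]: "(\<lambda>w. restrict w {1..t}) \<in> measurable (PA {1..Suc t}) (PA {1..t})"
    "(\<lambda>w. restrict w {1..t}) \<in> measurable (PB {1..Suc t}) (PB {1..t})"
    "(\<lambda>w. restrict w {1..<t}) \<in> measurable (PY {1..<Suc t}) (PY {1..<t})"
    by (auto intro!: measurable_restrict)
  have "expect \<pi> (Suc t) \<theta> (\<lambda>xA xB y. g (restrict xA {1..t}) (restrict xB {1..t}) (restrict y {1..<t})) =
    expect \<pi> t \<theta> (\<lambda>xA xB y. \<integral>\<^sup>+y'. ennreal (\<pi> t (\<theta>, xA, y, xB) y') *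
    (\<integral>\<^sup>+b. ennreal (ker_B S t (xB t, y') b) * (\<integral>\<^sup>+x. ennreal (ker_A S t (\<theta>, xA t, xB t) x) *
      g (restrict (xA(Suc t := x)) {1..t}) (restrict (xB(Suc t := b)) {1..t}) (restrict (y(t := y')) {1..<t}) \<partial>ref_A S) \<partial>ref_B S) \<partial>ref_Y S)"
    by (intro expect_Suc \<pi> \<theta> t) measurable
  also have "\<dots> = expect \<pi> t \<theta> g"
  proof (rule expect_cong)
    fix xA xB y
    assume sp [measurable]: "xA \<in> space (PA {1..t})" "xB \<in> space (PB {1..t})" "y \<in> space (PY {1..<t})"
    note [measurable] = \<theta>
    have sp' [measurable]: "xA t \<in> space (ref_A S)" "xB t \<in> space (ref_B S)"
      using sp t by (auto simp: space_PiM)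
    have r: "restrict (xA(Suc t := x)) {1..t} = xA" "restrict (xB(Suc t := b)) {1..t} = xB"
      "restrict (y(t := y')) {1..<t} = y" for x b y'
      using sp by (auto simp: fun_eq_iff restrict_def space_PiM PiE_def extensional_def)
    have A: "(\<integral>\<^sup>+x. ennreal (ker_A S t (\<theta>, xA t, xB t) x) * c \<partial>ref_A S) = c" for c
      using density_kernel_integral[OF ker_A[OF t], of "(\<theta>, xA t, xB t)"] sp' \<theta>
      by (subst nn_integral_multc) (auto simp: space_pair_measure)
    have B: "(\<integral>\<^sup>+b. ennreal (ker_B S t (xB t, y') b) * c \<partial>ref_B S) = c" if "y' \<in> space (ref_Y S)" for c y'
      using density_kernel_integral[OF ker_B[OF t], of "(xB t, y')"] sp' that
      by (subst nn_integral_multc) (auto simp: space_pair_measure)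
    have Y: "(\<integral>\<^sup>+y'. ennreal (\<pi> t (\<theta>, xA, y, xB) y') * c \<partial>ref_Y S) = c" for c
      using density_kernel_integral[OF policy_kernel[OF \<pi> t], of "(\<theta>, xA, y, xB)"] sp \<theta>
      by (subst nn_integral_multc) (auto simp: space_pair_measure)
    show "(\<integral>\<^sup>+y'. ennreal (\<pi> t (\<theta>, xA, y, xB) y') *
    (\<integral>\<^sup>+b. ennreal (ker_B S t (xB t, y') b) * (\<integral>\<^sup>+x. ennreal (ker_A S t (\<theta>, xA t, xB t) x) *
      g (restrict (xA(Suc t := x)) {1..t}) (restrict (xB(Suc t := b)) {1..t}) (restrict (y(t := y')) {1..<t}) \<partial>ref_A S) \<partial>ref_B S) \<partial>ref_Y S)
      = g xA xB y"
      by (simp add: r A B Y cong: nn_integral_cong_simp)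
  qed
  finally show ?thesis .
qed

text \<open>Needed at every \<open>\<theta>\<close>: it makes the marginal densities finite almost
  everywhere and gives the joint law total mass \<open>1\<close>.\<close>

lemma expect_one:
  assumes \<pi>: "\<pi> \<in> policies S" and \<theta>: "\<theta> \<in> space (ref_param S)" and t: "t \<in> {1..Suc (horizon S)}"
  shows "expect \<pi> t \<theta> (\<lambda>_ _ _. 1) = 1"
  using t
proof (induction t)
  case (Suc t)
  show ?case
  proof (cases "t = 0")
    \<comment> \<open>The induction runs from \<open>0\<close> but time starts at \<open>1\<close>,
      so this is the true base case, where only \<open>init\<close> is present.\<close>
    case True
    note [measurable] = \<theta>
    note [measurable (raw)] = density_kernel_measurable[OF init]
    interpret BY: sigma_finite_measure "PB {1} \<Otimes>\<^sub>M PY {}"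
      by (simp add: sigma_finite_PB_PY)
    interpret Y0: sigma_finite_measure "PY {}"
      by (simp add: sigma_finite_PY)
    \<comment> \<open>Nothing has been shared before time \<open>1\<close>; the empty product is a
      single point of mass \<open>1\<close>.\<close>
    have [simp]: "emeasure (PY {}) (space (PY {})) = 1"
      by (simp add: space_PiM PiM_empty)
    have "expect \<pi> 1 \<theta> (\<lambda>_ _ _. 1) =
        (\<integral>\<^sup>+p. ennreal (init S \<theta> (fst p 1, fst (snd p) 1)) \<partial>(PA {1} \<Otimes>\<^sub>M PB {1} \<Otimes>\<^sub>M PY {}))"
      by (simp add: expect_def history_density_def case_prod_unfold)
    also have "\<dots> = (\<integral>\<^sup>+xA. \<integral>\<^sup>+q. ennreal (init S \<theta> (xA 1, (fst q) 1)) \<partial>(PB {1} \<Otimes>\<^sub>M PY {}) \<partial>PA {1})"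
      by (subst BY.nn_integral_fst[symmetric]) measurable
    also have "\<dots> = (\<integral>\<^sup>+xA. \<integral>\<^sup>+xB. ennreal (init S \<theta> (xA 1, xB 1)) \<partial>PB {1} \<partial>PA {1})"
    proof (rule nn_integral_cong)
      fix xA assume "xA \<in> space (PA {1})"
      then have [measurable]: "xA 1 \<in> space (ref_A S)"
        by (auto simp: space_PiM)
      show "(\<integral>\<^sup>+q. ennreal (init S \<theta> (xA 1, (fst q) 1)) \<partial>(PB {1} \<Otimes>\<^sub>M PY {})) =
          (\<integral>\<^sup>+xB. ennreal (init S \<theta> (xA 1, xB 1)) \<partial>PB {1})"
        by (subst Y0.nn_integral_fst[symmetric]) simp_all
    qed
    also have "\<dots> = (\<integral>\<^sup>+xA. \<integral>\<^sup>+b. ennreal (init S \<theta> (xA 1, b)) \<partial>ref_B S \<partial>PA {1})"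
    proof (rule nn_integral_cong)
      fix xA assume "xA \<in> space (PA {1})"
      then have [measurable]: "xA 1 \<in> space (ref_A S)"
        by (auto simp: space_PiM)
      show "(\<integral>\<^sup>+xB. ennreal (init S \<theta> (xA 1, xB 1)) \<partial>PB {1}) =
          (\<integral>\<^sup>+b. ennreal (init S \<theta> (xA 1, b)) \<partial>ref_B S)"
        by (intro B.product_nn_integral_singleton) simp
    qed
    also have "\<dots> = (\<integral>\<^sup>+a. \<integral>\<^sup>+b. ennreal (init S \<theta> (a, b)) \<partial>ref_B S \<partial>ref_A S)"
      by (intro A.product_nn_integral_singleton) simp_all
    also have "\<dots> = 1"
      using density_kernel_integral[OF init \<theta>] by (subst sigma_finite_measure.nn_integral_fst[OF sigma_finite_ref_B]) simp_all
    finally show ?thesis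
      using True by (simp add: One_nat_def)
  next
    case False
    then show ?thesis
      using Suc expect_marginal[OF \<pi> \<theta>, of t "\<lambda>_ _ _. 1"] by simp
  qed
qed simp

subsection \<open>The conditional policy\<close>

text \<open>The density of \<open>(xA t, xB, y)\<close> given \<open>\<Theta> = \<theta>\<close>,
  the denominator of the conditional law.\<close>

definition marg_density where
  "marg_density \<pi> t = (\<lambda>(\<theta>, x, xB, y). \<integral>\<^sup>+r. history_density \<pi> t \<theta> (r(t := x)) xB y \<partial>PA {1..<t})"

text \<open>The numerator: the same marginal taken jointly with the data \<open>y'\<close> shared at
  time \<open>t\<close>.\<close>

definition marg_policy_density where
  "marg_policy_density \<pi> t = (\<lambda>(\<theta>, x, xB, y) y'.
    \<integral>\<^sup>+r. history_density \<pi> t \<theta> (r(t := x)) xB y * ennreal (\<pi> t (\<theta>, r(t := x), y, xB) y') \<partial>PA {1..<t})"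

text \<open>
  Where the conditional density is undefined any kernel will do; the fallback feeds a constant
  past to \<open>\<pi>\<close>. Where \<open>marg_policy_density\<close> is infinite, \<open>enn2real\<close> gives \<open>0\<close>.
\<close>

definition simplify where
  "simplify \<pi> t = (\<lambda>(\<theta>, x, xB, y) y'.
     if marg_density \<pi> t (\<theta>, x, xB, y) \<in> {0<..<\<infinity>}
     then enn2real (marg_policy_density \<pi> t (\<theta>, x, xB, y) y' / marg_density \<pi> t (\<theta>, x, xB, y))
     else \<pi> t (\<theta>, \<lambda>_\<in>{1..t}. x, y, xB) y')"

text \<open>The variables conditioned on besides \<open>\<theta>\<close>, which is kept
  fixed.\<close>

abbreviation "snapshot t \<equiv> ref_A S \<Otimes>\<^sub>M PB {1..t} \<Otimes>\<^sub>M PY {1..<t}"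

section \<open>The quotient is a kernel\<close>

lemma measurable_marg_density:
  assumes "\<pi> \<in> policies S" and t: "t \<in> {1..horizon S}"
  shows "marg_density \<pi> t \<in> borel_measurable (ref_param S \<Otimes>\<^sub>M snapshot t)"
proof -
  interpret R: sigma_finite_measure "PA {1..<t}"
    by (simp add: sigma_finite_PA)
  note [measurable (raw)] = measurable_history_density[OF assms(1)]
  have "1 \<le> t" "t \<le> Suc (horizon S)"
    using t by auto
  then show ?thesis
    unfolding marg_density_def case_prod_unfold by measurable
qed

lemma measurable_marg_policy_density:
  assumes "\<pi> \<in> policies S" and t: "t \<in> {1..horizon S}"
  shows "(\<lambda>(h, y'). marg_policy_density \<pi> t h y') \<in>
    borel_measurable ((ref_param S \<Otimes>\<^sub>M snapshot t) \<Otimes>\<^sub>M ref_Y S)"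
proof -
  interpret R: sigma_finite_measure "PA {1..<t}"
    by (simp add: sigma_finite_PA)
  note [measurable (raw)] = measurable_history_density[OF assms(1)]
    density_kernel_measurable[OF policy_kernel[OF assms]]
  have "1 \<le> t" "t \<le> Suc (horizon S)"
    using t by auto
  then show ?thesis
    unfolding marg_policy_density_def case_prod_unfold by measurable
qed

text \<open>By Tonelli the integral over \<open>y'\<close> can be taken first, and for each past of
  \<open>A\<close> the policy integrates to \<open>1\<close>.\<close>

lemma nn_integral_marg_policy_density:
  assumes "\<pi> \<in> policies S" and t: "t \<in> {1..horizon S}" and h: "h \<in> space (ref_param S \<Otimes>\<^sub>M snapshot t)"
  shows "(\<integral>\<^sup>+y'. marg_policy_density \<pi> t h y' \<partial>ref_Y S) = marg_density \<pi> t h"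
proof -
  interpret R: sigma_finite_measure "PA {1..<t}"
    by (simp add: sigma_finite_PA)
  interpret Y1: sigma_finite_measure "ref_Y S"
    by (rule sigma_finite_ref_Y)
  interpret RY: pair_sigma_finite "PA {1..<t}" "ref_Y S" ..
  note [measurable (raw)] = measurable_history_density[OF assms(1)]
    density_kernel_measurable[OF policy_kernel[OF assms(1,2)]]
  have t1: "1 \<le> t" "t \<le> Suc (horizon S)"
    using t by auto
  obtain \<theta> x xB y where h_eq: "h = (\<theta>, x, xB, y)"
    by (metis surj_pair)
  have sp [measurable]: "\<theta> \<in> space (ref_param S)" "x \<in> space (ref_A S)" "xB \<in> space (PB {1..t})"
    "y \<in> space (PY {1..<t})"
    using h by (auto simp: h_eq space_pair_measure)
  have "(\<integral>\<^sup>+y'. marg_policy_density \<pi> t h y' \<partial>ref_Y S) =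
    (\<integral>\<^sup>+r. \<integral>\<^sup>+y'. history_density \<pi> t \<theta> (r(t := x)) xB y * ennreal (\<pi> t (\<theta>, r(t := x), y, xB) y')
      \<partial>ref_Y S \<partial>PA {1..<t})"
    unfolding h_eq marg_policy_density_def prod.case
    using t1 by (intro RY.Fubini') measurable
  also have "\<dots> = (\<integral>\<^sup>+r. history_density \<pi> t \<theta> (r(t := x)) xB y \<partial>PA {1..<t})"
  proof (rule nn_integral_cong)
    fix r assume [measurable]: "r \<in> space (PA {1..<t})"
    have rs [measurable]: "r(t := x) \<in> space (PA {1..t})"
      using t1 sp \<open>r \<in> _\<close> by (auto simp: space_PiM PiE_def extensional_def Pi_iff)
    then show "(\<integral>\<^sup>+y'. history_density \<pi> t \<theta> (r(t := x)) xB y * ennreal (\<pi> t (\<theta>, r(t := x), y, xB) y') \<partial>ref_Y S) =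
      history_density \<pi> t \<theta> (r(t := x)) xB y"
      using density_kernel_integral[OF policy_kernel[OF assms(1,2)], of "(\<theta>, r(t := x), y, xB)"] sp
      by (subst nn_integral_cmult) (auto simp: space_pair_measure)
  qed
  also have "\<dots> = marg_density \<pi> t h"
    by (simp add: h_eq marg_density_def)
  finally show ?thesis .
qed

text \<open>Normalisation is required at every argument. The fallback is a density because
  \<open>\<pi> t\<close> is one everywhere; the quotient is one because numerator and denominator
  have the same integral over \<open>y'\<close>.\<close>

lemma simplify_kernel:
  assumes \<pi>: "\<pi> \<in> policies S" and t: "t \<in> {1..horizon S}"
  shows "density_kernel (ref_param S \<Otimes>\<^sub>M snapshot t) (ref_Y S) (simplify \<pi> t)"
  unfolding density_kernel_def
proof (intro conjI ballI)
  note [measurable (raw)] = density_kernel_measurable[OF policy_kernel[OF assms]]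
  note [measurable] = measurable_marg_density[OF assms] measurable_marg_policy_density[OF assms]
  have [measurable]: "(\<lambda>w. (\<lambda>_\<in>{1..t}. fst (snd (fst w)))) \<in>
      measurable ((ref_param S \<Otimes>\<^sub>M snapshot t) \<Otimes>\<^sub>M ref_Y S) (PA {1..t})"
    by (auto intro!: measurable_restrict)
  show "(\<lambda>(h, y). simplify \<pi> t h y) \<in> borel_measurable ((ref_param S \<Otimes>\<^sub>M snapshot t) \<Otimes>\<^sub>M ref_Y S)"
  proof -
    have [measurable]: "(\<lambda>w. marg_policy_density \<pi> t (fst w) (snd w)) \<in>
        borel_measurable ((ref_param S \<Otimes>\<^sub>M snapshot t) \<Otimes>\<^sub>M ref_Y S)"
      using measurable_marg_policy_density[OF assms] by (simp add: case_prod_unfold)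
    show ?thesis
      unfolding simplify_def case_prod_unfold prod.collapse by measurable
  qed
  fix h assume h: "h \<in> space (ref_param S \<Otimes>\<^sub>M snapshot t)"
  obtain \<theta> x xB y where h_eq: "h = (\<theta>, x, xB, y)"
    by (metis surj_pair)
  let ?m = "marg_density \<pi> t h" and ?n = "marg_policy_density \<pi> t h"
  show "is_density (ref_Y S) (simplify \<pi> t h)"
  proof (cases "?m \<in> {0<..<\<infinity>}")
    case False
    have "(\<theta>, \<lambda>_\<in>{1..t}. x, y, xB) \<in> space (ref_param S \<Otimes>\<^sub>M PA {1..t} \<Otimes>\<^sub>M PY {1..<t} \<Otimes>\<^sub>M PB {1..t})"
      using h by (auto simp: h_eq space_pair_measure space_PiM)
    moreover have "simplify \<pi> t h = \<pi> t (\<theta>, \<lambda>_\<in>{1..t}. x, y, xB)"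
      using False unfolding simplify_def h_eq prod.case fun_eq_iff by auto
    ultimately show ?thesis
      using policy_kernel[OF assms] by (simp add: density_kernel_def)
  next
    case True
    have [measurable]: "?n \<in> borel_measurable (ref_Y S)"
      using measurable_compose[OF measurable_Pair1'[OF h] measurable_marg_policy_density[OF assms]]
      by simp
    have eq: "simplify \<pi> t h = (\<lambda>y'. enn2real (?n y' / ?m))"
      using True by (auto simp: simplify_def h_eq fun_eq_iff)
    have int: "(\<integral>\<^sup>+y'. ?n y' \<partial>ref_Y S) = ?m"
      by (rule nn_integral_marg_policy_density[OF assms h])
    \<comment> \<open>The numerator has the finite integral \<open>?m\<close>, so
      \<open>enn2real\<close> alters the quotient only on a null set.\<close>
    have "AE y' in ref_Y S. ?n y' \<noteq> \<infinity>"
      using True by (intro nn_integral_PInf_AE) (auto simp: int)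
    then have "(\<integral>\<^sup>+y'. ennreal (simplify \<pi> t h y') \<partial>ref_Y S) = (\<integral>\<^sup>+y'. ?n y' / ?m \<partial>ref_Y S)"
      unfolding eq
    proof (intro nn_integral_cong_AE, elim AE_mp, intro AE_I2 impI)
      fix y' assume "?n y' \<noteq> \<infinity>"
      then have "?n y' / ?m < top"
        using True by (auto simp: less_top[symmetric] ennreal_divide_eq_top_iff)
      then show "ennreal (enn2real (?n y' / ?m)) = ?n y' / ?m"
        by simp
    qed
    also have "\<dots> = 1"
      using True by (auto simp: nn_integral_divide int intro!: ennreal_divide_self)
    finally show ?thesis
      by (simp add: is_density_def eq)
  qed
qed

text \<open>Ensures that, for each fixed \<open>\<theta>\<close>, the denominator is infinite only
  on a null set of snapshots.\<close>

lemma nn_integral_marg_density: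
  assumes \<pi>: "\<pi> \<in> policies S" and \<theta>: "\<theta> \<in> space (ref_param S)" and t: "t \<in> {1..horizon S}"
  shows "(\<integral>\<^sup>+z. marg_density \<pi> t (\<theta>, z) \<partial>snapshot t) = 1"
proof -
  note [measurable] = \<theta>
  note [measurable (raw)] = measurable_history_density[OF \<pi>]
  have t1: "1 \<le> t" "t \<le> Suc (horizon S)" "t \<in> {1..Suc (horizon S)}"
    using t by auto
  have "1 = (\<integral>\<^sup>+(xA, xB, y). history_density \<pi> t \<theta> xA xB y \<partial>traj t)"
    using expect_one[OF \<pi> \<theta> t1(3)] by (simp add: expect_def)
  also have "\<dots> = (\<integral>\<^sup>+z. (case z of (x, xB, y) \<Rightarrow>
    \<integral>\<^sup>+r. history_density \<pi> t \<theta> (r(t := x)) xB y \<partial>PA {1..<t}) \<partial>snapshot t)"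
    using t1 by (subst nn_integral_traj_disintegrate) (auto simp: case_prod_unfold)
  also have "\<dots> = (\<integral>\<^sup>+z. marg_density \<pi> t (\<theta>, z) \<partial>snapshot t)"
    by (simp add: marg_density_def case_prod_unfold)
  finally show ?thesis by simp
qed

text \<open>Bayes' rule in product form, which unlike the quotient also makes sense where the
  denominator is zero. The exceptional sets lie in the snapshot and in \<open>y'\<close>;
  \<open>\<theta>\<close> is arbitrary.\<close>

lemma AE_marg_policy_density:
  assumes \<pi>: "\<pi> \<in> policies S" and \<theta>: "\<theta> \<in> space (ref_param S)" and t: "t \<in> {1..horizon S}"
  shows "AE z in snapshot t. AE y' in ref_Y S.
    marg_policy_density \<pi> t (\<theta>, z) y' = marg_density \<pi> t (\<theta>, z) * ennreal (simplify \<pi> t (\<theta>, z) y')"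
proof -
  note [measurable] = \<theta> measurable_marg_density[OF \<pi> t]
  have fin: "AE z in snapshot t. marg_density \<pi> t (\<theta>, z) \<noteq> \<infinity>"
    using nn_integral_marg_density[OF assms] by (intro nn_integral_PInf_AE) auto
  have "AE z in snapshot t. marg_density \<pi> t (\<theta>, z) \<noteq> \<infinity> \<longrightarrow> (AE y' in ref_Y S.
    marg_policy_density \<pi> t (\<theta>, z) y' = marg_density \<pi> t (\<theta>, z) * ennreal (simplify \<pi> t (\<theta>, z) y'))"
  proof (rule AE_I2, rule impI)
    fix z assume z: "z \<in> space (snapshot t)" and fin: "marg_density \<pi> t (\<theta>, z) \<noteq> \<infinity>"
    let ?m = "marg_density \<pi> t (\<theta>, z)" and ?n = "marg_policy_density \<pi> t (\<theta>, z)"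
    have h: "(\<theta>, z) \<in> space (ref_param S \<Otimes>\<^sub>M snapshot t)"
      using z \<theta> by (simp add: space_pair_measure)
    have int: "(\<integral>\<^sup>+y'. ?n y' \<partial>ref_Y S) = ?m"
      by (rule nn_integral_marg_policy_density[OF \<pi> t h])
    have [measurable]: "?n \<in> borel_measurable (ref_Y S)"
      using measurable_compose[OF measurable_Pair1'[OF h] measurable_marg_policy_density[OF \<pi> t]]
      by simp
    show "AE y' in ref_Y S. ?n y' = ?m * ennreal (simplify \<pi> t (\<theta>, z) y')"
    proof (cases "?m = 0")
      \<comment> \<open>The right-hand side is zero whatever the fallback is, and the numerator
        vanishes almost everywhere because its integral is zero.\<close>
      case True
      then show ?thesis
        using int by (simp add: nn_integral_0_iff_AE)
    next
      case False
      then have m: "?m \<in> {0<..<\<infinity>}"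
        using fin by (auto simp: less_top zero_less_iff_neq_zero)
      then have eq: "simplify \<pi> t (\<theta>, z) y' = enn2real (?n y' / ?m)" for y'
        by (auto simp: simplify_def case_prod_unfold)
      have "AE y' in ref_Y S. ?n y' \<noteq> \<infinity>"
        using m by (intro nn_integral_PInf_AE) (auto simp: int)
      then show ?thesis
      proof (rule AE_mp, intro AE_I2 impI)
        fix y' assume "?n y' \<noteq> \<infinity>"
        then have "?n y' / ?m < top"
          using m by (auto simp: less_top[symmetric] ennreal_divide_eq_top_iff)
        then have "?m * ennreal (simplify \<pi> t (\<theta>, z) y') = ?m * (?n y' / ?m)"
          by (simp add: eq)
        also have "\<dots> = ?n y'"
          using m by (auto simp: ennreal_times_divide mult.commute[of ?m] intro!: mult_divide_eq_ennreal)
        finally show "?n y' = ?m * ennreal (simplify \<pi> t (\<theta>, z) y')" ..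
      qed
    qed
  qed
  with fin show ?thesis
    by (rule AE_mp)
qed

text \<open>First exchange: only the policy at time \<open>t\<close> changes, the law of the history
  stays that of \<open>\<pi>\<close>. Since \<open>G\<close> sees \<open>A\<close> only through its
  current state, the past of \<open>A\<close> can be integrated out, Bayes' rule applied, and the
  past put back.\<close>

lemma expect_simplify:
  fixes G :: "(real ^ 'na) \<times> (nat \<Rightarrow> real ^ 'nb) \<times> (nat \<Rightarrow> 'y) \<Rightarrow> 'y \<Rightarrow> ennreal"
  assumes \<pi>: "\<pi> \<in> policies S" and \<theta>: "\<theta> \<in> space (ref_param S)" and t: "t \<in> {1..horizon S}"
    and G: "(\<lambda>(z, y'). G z y') \<in> borel_measurable (snapshot t \<Otimes>\<^sub>M ref_Y S)"
  shows "expect \<pi> t \<theta> (\<lambda>xA xB y. \<integral>\<^sup>+y'. ennreal (\<pi> t (\<theta>, xA, y, xB) y') * G (xA t, xB, y) y' \<partial>ref_Y S) =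
    expect \<pi> t \<theta> (\<lambda>xA xB y. \<integral>\<^sup>+y'. ennreal (simplify \<pi> t (\<theta>, xA t, xB, y) y') * G (xA t, xB, y) y' \<partial>ref_Y S)"
    (is "?L = ?R")
proof -
  interpret R: sigma_finite_measure "PA {1..<t}"
    by (simp add: sigma_finite_PA)
  interpret Y1: sigma_finite_measure "ref_Y S"
    by (rule sigma_finite_ref_Y)
  interpret RY: pair_sigma_finite "PA {1..<t}" "ref_Y S" ..
  note [measurable] = \<theta>
  note [measurable (raw)] = measurable_history_density[OF \<pi>] measurable_curry2[OF G]
    density_kernel_measurable[OF policy_kernel[OF \<pi> t]]
    density_kernel_measurable[OF simplify_kernel[OF \<pi> t]]
  have t1: "1 \<le> t" "t \<le> Suc (horizon S)" "t \<in> {1..t}"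
    using t by auto
  have "?L = (\<integral>\<^sup>+z. (case z of (x, xB, y) \<Rightarrow> \<integral>\<^sup>+r. history_density \<pi> t \<theta> (r(t := x)) xB y *
      (\<integral>\<^sup>+y'. ennreal (\<pi> t (\<theta>, r(t := x), y, xB) y') * G (x, xB, y) y' \<partial>ref_Y S) \<partial>PA {1..<t}) \<partial>snapshot t)"
    unfolding expect_def using t1 by (subst nn_integral_traj_disintegrate) (auto simp: case_prod_unfold)
  also have "\<dots> = (\<integral>\<^sup>+z. \<integral>\<^sup>+y'. marg_policy_density \<pi> t (\<theta>, z) y' * G z y' \<partial>ref_Y S \<partial>snapshot t)"
  proof (intro nn_integral_cong, clarify)
    fix x xB y assume "(x, xB, y) \<in> space (snapshot t)"
    then have [measurable]: "x \<in> space (ref_A S)" "xB \<in> space (PB {1..t})" "y \<in> space (PY {1..<t})"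
      by (auto simp: space_pair_measure)
    have "(\<integral>\<^sup>+r. history_density \<pi> t \<theta> (r(t := x)) xB y *
      (\<integral>\<^sup>+y'. ennreal (\<pi> t (\<theta>, r(t := x), y, xB) y') * G (x, xB, y) y' \<partial>ref_Y S) \<partial>PA {1..<t}) =
      (\<integral>\<^sup>+r. \<integral>\<^sup>+y'. history_density \<pi> t \<theta> (r(t := x)) xB y *
        ennreal (\<pi> t (\<theta>, r(t := x), y, xB) y') * G (x, xB, y) y' \<partial>ref_Y S \<partial>PA {1..<t})"
      using t1 by (simp add: nn_integral_cmult mult.assoc cong: nn_integral_cong_simp)
    also have "\<dots> = (\<integral>\<^sup>+y'. \<integral>\<^sup>+r. history_density \<pi> t \<theta> (r(t := x)) xB y *
        ennreal (\<pi> t (\<theta>, r(t := x), y, xB) y') * G (x, xB, y) y' \<partial>PA {1..<t} \<partial>ref_Y S)"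
      using t1 by (intro RY.Fubini'[symmetric]) measurable
    also have "\<dots> = (\<integral>\<^sup>+y'. marg_policy_density \<pi> t (\<theta>, x, xB, y) y' * G (x, xB, y) y' \<partial>ref_Y S)"
      using t1 by (simp add: nn_integral_multc marg_policy_density_def cong: nn_integral_cong_simp)
    finally show "(\<integral>\<^sup>+r. history_density \<pi> t \<theta> (r(t := x)) xB y *
      (\<integral>\<^sup>+y'. ennreal (\<pi> t (\<theta>, r(t := x), y, xB) y') * G (x, xB, y) y' \<partial>ref_Y S) \<partial>PA {1..<t}) =
      (\<integral>\<^sup>+y'. marg_policy_density \<pi> t (\<theta>, x, xB, y) y' * G (x, xB, y) y' \<partial>ref_Y S)" .
  qed
  also have "\<dots> = (\<integral>\<^sup>+z. marg_density \<pi> t (\<theta>, z) *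
      (\<integral>\<^sup>+y'. ennreal (simplify \<pi> t (\<theta>, z) y') * G z y' \<partial>ref_Y S) \<partial>snapshot t)"
    using AE_marg_policy_density[OF \<pi> \<theta> t]
  proof (intro nn_integral_cong_AE, elim AE_mp, intro AE_I2 impI)
    fix z assume [measurable]: "z \<in> space (snapshot t)"
      and ae: "AE y' in ref_Y S. marg_policy_density \<pi> t (\<theta>, z) y' =
        marg_density \<pi> t (\<theta>, z) * ennreal (simplify \<pi> t (\<theta>, z) y')"
    have "(\<integral>\<^sup>+y'. marg_policy_density \<pi> t (\<theta>, z) y' * G z y' \<partial>ref_Y S) =
      (\<integral>\<^sup>+y'. marg_density \<pi> t (\<theta>, z) * (ennreal (simplify \<pi> t (\<theta>, z) y') * G z y') \<partial>ref_Y S)"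
      using ae by (intro nn_integral_cong_AE) (auto simp: mult.assoc)
    also have "\<dots> = marg_density \<pi> t (\<theta>, z) *
      (\<integral>\<^sup>+y'. ennreal (simplify \<pi> t (\<theta>, z) y') * G z y' \<partial>ref_Y S)"
      by (intro nn_integral_cmult) measurable
    finally show "(\<integral>\<^sup>+y'. marg_policy_density \<pi> t (\<theta>, z) y' * G z y' \<partial>ref_Y S) =
      marg_density \<pi> t (\<theta>, z) * (\<integral>\<^sup>+y'. ennreal (simplify \<pi> t (\<theta>, z) y') * G z y' \<partial>ref_Y S)" .
  qed
  also have "\<dots> = (\<integral>\<^sup>+z. (case z of (x, xB, y) \<Rightarrow> \<integral>\<^sup>+r. history_density \<pi> t \<theta> (r(t := x)) xB y *
      (\<integral>\<^sup>+y'. ennreal (simplify \<pi> t (\<theta>, x, xB, y) y') * G (x, xB, y) y' \<partial>ref_Y S) \<partial>PA {1..<t}) \<partial>snapshot t)"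
  proof (intro nn_integral_cong, clarify)
    fix x xB y assume "(x, xB, y) \<in> space (snapshot t)"
    then have [measurable]: "x \<in> space (ref_A S)" "xB \<in> space (PB {1..t})" "y \<in> space (PY {1..<t})"
      by (auto simp: space_pair_measure)
    show "marg_density \<pi> t (\<theta>, x, xB, y) *
      (\<integral>\<^sup>+y'. ennreal (simplify \<pi> t (\<theta>, x, xB, y) y') * G (x, xB, y) y' \<partial>ref_Y S) =
      (\<integral>\<^sup>+r. history_density \<pi> t \<theta> (r(t := x)) xB y *
      (\<integral>\<^sup>+y'. ennreal (simplify \<pi> t (\<theta>, x, xB, y) y') * G (x, xB, y) y' \<partial>ref_Y S) \<partial>PA {1..<t})"
      using t1 by (subst nn_integral_multc) (auto simp: marg_density_def)
  qed
  also have "\<dots> = ?R"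
    unfolding expect_def using t1 by (subst nn_integral_traj_disintegrate) (auto simp: case_prod_unfold)
  finally show ?thesis .
qed

section \<open>Induction over time\<close>

lemma as_policy_apply: "as_policy \<sigma> t (\<theta>, xA, y, xB) = \<sigma> t (\<theta>, xA t, xB, y)"
  by (simp add: as_policy_def)

lemma as_policy_simplify:
  "\<pi> \<in> policies S \<Longrightarrow> as_policy (simplify \<pi>) \<in> simplified_policies S"
  using simplify_kernel by (auto simp: simplified_policies_def)

text \<open>The conclusion keeps two consecutive states of \<open>A\<close>, more than the next
  induction step needs, because the cost depends on both.\<close>

lemma expect_as_policy_simplify_Suc:
  fixes g :: "(real ^ 'na) \<times> (real ^ 'na) \<times> (nat \<Rightarrow> real ^ 'nb) \<times> (nat \<Rightarrow> 'y) \<Rightarrow> ennreal"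
  assumes \<pi>: "\<pi> \<in> policies S" and \<theta>: "\<theta> \<in> space (ref_param S)" and t: "t \<in> {1..horizon S}"
    and IH: "\<And>G. G \<in> borel_measurable (snapshot t) \<Longrightarrow>
      expect \<pi> t \<theta> (\<lambda>xA xB y. G (xA t, xB, y)) =
      expect (as_policy (simplify \<pi>)) t \<theta> (\<lambda>xA xB y. G (xA t, xB, y))"
    and g [measurable]: "g \<in> borel_measurable (ref_A S \<Otimes>\<^sub>M snapshot (Suc t))"
  shows "expect \<pi> (Suc t) \<theta> (\<lambda>xA xB y. g (xA t, xA (Suc t), xB, y)) =
    expect (as_policy (simplify \<pi>)) (Suc t) \<theta> (\<lambda>xA xB y. g (xA t, xA (Suc t), xB, y))"
proof -
  have \<sigma>: "as_policy (simplify \<pi>) \<in> policies S"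
    using as_policy_simplify[OF \<pi>] simplified_policies_subset by blast
  have t1: "1 \<le> t" "t \<in> {1..t}" "t \<in> {1..Suc t}" "Suc t \<in> {1..Suc t}"
    using t by auto
  note [measurable] = \<theta>
  note [measurable (raw)] = density_kernel_measurable[OF ker_A[OF t]]
    density_kernel_measurable[OF ker_B[OF t]] density_kernel_measurable[OF simplify_kernel[OF \<pi> t]]
  \<comment> \<open>The expectation of \<open>g\<close> given the snapshot and
    \<open>Y_t = y'\<close>. It involves no policy and no older state of \<open>A\<close>, because
    the transition kernels read current states only.\<close>
  define G where "G = (\<lambda>(x, xB, y) y'.
    \<integral>\<^sup>+b. ennreal (ker_B S t (xB t, y') b) * (\<integral>\<^sup>+x'. ennreal (ker_A S t (\<theta>, x, xB t) x') *
      g (x, x', xB(Suc t := b), y(t := y')) \<partial>ref_A S) \<partial>ref_B S)"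
  have G: "(\<lambda>(z, y'). G z y') \<in> borel_measurable (snapshot t \<Otimes>\<^sub>M ref_Y S)"
    unfolding G_def case_prod_unfold using t1 by measurable
  note [measurable (raw)] = measurable_curry2[OF G]
  have g': "(\<lambda>(xA, xB, y). g (xA t, xA (Suc t), xB, y)) \<in> borel_measurable (traj (Suc t))"
    using t1 by measurable
  have "expect \<pi> (Suc t) \<theta> (\<lambda>xA xB y. g (xA t, xA (Suc t), xB, y)) =
    expect \<pi> t \<theta> (\<lambda>xA xB y. \<integral>\<^sup>+y'. ennreal (\<pi> t (\<theta>, xA, y, xB) y') * G (xA t, xB, y) y' \<partial>ref_Y S)"
    by (simp add: expect_Suc[OF \<pi> \<theta> t g'] G_def)
  also have "\<dots> = expect \<pi> t \<theta> (\<lambda>xA xB y.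
      \<integral>\<^sup>+y'. ennreal (simplify \<pi> t (\<theta>, xA t, xB, y) y') * G (xA t, xB, y) y' \<partial>ref_Y S)"
    by (rule expect_simplify[OF \<pi> \<theta> t G])
  \<comment> \<open>Second exchange: the integrand is now a function of the snapshot alone, so the
    induction hypothesis changes the law of the history.\<close>
  also have "\<dots> = expect (as_policy (simplify \<pi>)) t \<theta> (\<lambda>xA xB y.
      \<integral>\<^sup>+y'. ennreal (simplify \<pi> t (\<theta>, xA t, xB, y) y') * G (xA t, xB, y) y' \<partial>ref_Y S)"
    by (rule IH[of "\<lambda>z. \<integral>\<^sup>+y'. ennreal (simplify \<pi> t (\<theta>, z) y') * G z y' \<partial>ref_Y S"]) measurable
  also have "\<dots> = expect (as_policy (simplify \<pi>)) (Suc t) \<theta> (\<lambda>xA xB y. g (xA t, xA (Suc t), xB, y))"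
    unfolding expect_Suc[OF \<sigma> \<theta> t g'] by (simp add: G_def as_policy_apply)
  finally show ?thesis .
qed

lemma expect_as_policy_simplify:
  fixes g :: "(real ^ 'na) \<times> (nat \<Rightarrow> real ^ 'nb) \<times> (nat \<Rightarrow> 'y) \<Rightarrow> ennreal"
  assumes \<pi>: "\<pi> \<in> policies S" and \<theta>: "\<theta> \<in> space (ref_param S)" and t: "t \<in> {1..horizon S}"
    and g: "g \<in> borel_measurable (snapshot t)"
  shows "expect \<pi> t \<theta> (\<lambda>xA xB y. g (xA t, xB, y)) =
    expect (as_policy (simplify \<pi>)) t \<theta> (\<lambda>xA xB y. g (xA t, xB, y))"
  using t g
proof (induction t arbitrary: g)
  case (Suc t)
  show ?case
  proof (cases "t = 0")
    \<comment> \<open>At time \<open>1\<close> no policy has acted yet, so both sides are literally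
      the same integral.\<close>
    case True
    then show ?thesis
      by (simp add: expect_def history_density_def One_nat_def)
  next
    case False
    then have t: "t \<in> {1..horizon S}"
      using Suc.prems by auto
    \<comment> \<open>The older of the two states of \<open>A\<close> is discarded to return to a
      snapshot.\<close>
    have m: "(\<lambda>(_, z). g z) \<in> borel_measurable (ref_A S \<Otimes>\<^sub>M snapshot (Suc t))"
      using Suc.prems by measurable
    show ?thesis
      using expect_as_policy_simplify_Suc[OF \<pi> \<theta> t Suc.IH[OF t] m] unfolding prod.case .
  qed
qed simp

text \<open>Iterated marginalisation from time \<open>s\<close> down to \<open>Suc t\<close>; the
  restrictions turn a function of short trajectories into one of long trajectories.\<close>

lemma expect_prefix:
  fixes g :: "(real ^ 'na) \<times> (real ^ 'na) \<times> (nat \<Rightarrow> real ^ 'nb) \<times> (nat \<Rightarrow> 'y) \<Rightarrow> ennreal"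
  assumes \<pi>: "\<pi> \<in> policies S" and \<theta>: "\<theta> \<in> space (ref_param S)" and t: "1 \<le> t" "Suc t \<le> s" "s \<le> Suc (horizon S)"
    and g [measurable]: "g \<in> borel_measurable (ref_A S \<Otimes>\<^sub>M snapshot (Suc t))"
  shows "expect \<pi> s \<theta> (\<lambda>xA xB y. g (xA t, xA (Suc t), restrict xB {1..Suc t}, restrict y {1..<Suc t})) =
    expect \<pi> (Suc t) \<theta> (\<lambda>xA xB y. g (xA t, xA (Suc t), xB, y))"
  using t(2,3)
proof (induction s rule: dec_induct)
  case base
  show ?case
    by (intro expect_cong) (simp add: restrict_space_PiM)
next
  case (step s)
  let ?g = "\<lambda>xA xB y. g (xA t, xA (Suc t), restrict xB {1..Suc t}, restrict y {1..<Suc t})"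
  have s: "s \<in> {1..horizon S}" and ts: "t \<in> {1..s}" "Suc t \<in> {1..s}"
    using t step by auto
  have [measurable]: "(\<lambda>w. restrict w {1..Suc t}) \<in> measurable (PB {1..s}) (PB {1..Suc t})"
    "(\<lambda>w. restrict w {1..<Suc t}) \<in> measurable (PY {1..<s}) (PY {1..<Suc t})"
    using step by (auto intro!: measurable_restrict)
  have m: "(\<lambda>(xA, xB, y). ?g xA xB y) \<in> borel_measurable (traj s)"
    using ts by measurable
  \<comment> \<open>Restricting to times up to \<open>s\<close> beforehand changes nothing, which
    brings the integrand into the form that \<open>expect_marginal\<close> expects.\<close>
  have "{1..s} \<inter> {1..Suc t} = {1..Suc t}" "{1..<s} \<inter> {1..<Suc t} = {1..<Suc t}"
    using step by auto
  then have "expect \<pi> (Suc s) \<theta> ?g = expect \<pi> (Suc s) \<theta>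
      (\<lambda>xA xB y. ?g (restrict xA {1..s}) (restrict xB {1..s}) (restrict y {1..<s}))"
    using ts by simp
  also have "\<dots> = expect \<pi> s \<theta> ?g"
    by (rule expect_marginal[OF \<pi> \<theta> s m])
  also have "\<dots> = expect \<pi> (Suc t) \<theta> (\<lambda>xA xB y. g (xA t, xA (Suc t), xB, y))"
    using step.prems by (intro step.IH) simp
  finally show ?case .
qed

lemma expect_horizon_as_policy_simplify:
  fixes g :: "(real ^ 'na) \<times> (real ^ 'na) \<times> (nat \<Rightarrow> real ^ 'nb) \<times> (nat \<Rightarrow> 'y) \<Rightarrow> ennreal"
  assumes \<pi>: "\<pi> \<in> policies S" and \<theta>: "\<theta> \<in> space (ref_param S)" and t: "t \<in> {1..horizon S}"
    and g: "g \<in> borel_measurable (ref_A S \<Otimes>\<^sub>M snapshot (Suc t))"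
  defines "g' \<equiv> \<lambda>xA xB y. g (xA t, xA (Suc t), restrict xB {1..Suc t}, restrict y {1..<Suc t})"
  shows "expect \<pi> (Suc (horizon S)) \<theta> g' = expect (as_policy (simplify \<pi>)) (Suc (horizon S)) \<theta> g'"
proof -
  have \<sigma>: "as_policy (simplify \<pi>) \<in> policies S"
    using as_policy_simplify[OF \<pi>] simplified_policies_subset by blast
  show ?thesis
    unfolding g'_def using t
    by (simp add: expect_prefix[OF \<pi> \<theta> _ _ _ g] expect_prefix[OF \<sigma> \<theta> _ _ _ g]
      expect_as_policy_simplify_Suc[OF \<pi> \<theta> t expect_as_policy_simplify[OF \<pi> \<theta> t] g])
qed

subsection \<open>Comparison of the joint laws\<close>

text \<open>Moving \<open>ennreal\<close> inside the product needs nonnegative factors, which the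
  kernels guarantee only at points of the spaces.\<close>

lemma ennreal_joint_density:
  assumes \<pi>: "\<pi> \<in> policies S" and \<theta>: "\<theta> \<in> space (ref_param S)"
    and sp: "xA \<in> space (PA {1..Suc (horizon S)})" "xB \<in> space (PB {1..Suc (horizon S)})"
      "y \<in> space (PY {1..horizon S})"
  shows "ennreal (joint_density S \<pi> \<theta> xA xB y) =
    ennreal (prior S \<theta>) * history_density \<pi> (Suc (horizon S)) \<theta> xA xB y"
proof -
  have A: "xA s \<in> space (ref_A S)" "xB s \<in> space (ref_B S)" if "s \<in> {1..Suc (horizon S)}" for s
    using sp that by (auto simp: space_PiM)
  have Y: "y s \<in> space (ref_Y S)" if "s \<in> {1..horizon S}" for s
    using sp that by (auto simp: space_PiM)
  have n0: "0 \<le> prior S \<theta>" "0 \<le> init S \<theta> (xA 1, xB 1)"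
    using prior \<theta> A[of 1] density_kernel_nonneg[OF init \<theta>]
    by (auto simp: is_density_def space_pair_measure)
  have n: "0 \<le> \<pi> s (\<theta>, restrict xA {1..s}, restrict y {1..<s}, restrict xB {1..s}) (y s)"
      "0 \<le> ker_A S s (\<theta>, xA s, xB s) (xA (Suc s))"
      "0 \<le> ker_B S s (xB s, y s) (xB (Suc s))" if s: "s \<in> {1..horizon S}" for s
    using s \<theta> by (auto intro!: density_kernel_nonneg[OF policy_kernel[OF \<pi> s]]
      density_kernel_nonneg[OF ker_A[OF s]] density_kernel_nonneg[OF ker_B[OF s]] A Y
      simp: space_pair_measure space_PiM)
  define p where "p = (\<Prod>s = 1..horizon S.
        \<pi> s (\<theta>, restrict xA {1..s}, restrict y {1..<s}, restrict xB {1..s}) (y s) *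
        ker_A S s (\<theta>, xA s, xB s) (xA (s + 1)) *
        ker_B S s (xB s, y s) (xB (s + 1)))"
  have p0: "0 \<le> p"
    using n unfolding p_def by (intro prod_nonneg) (auto simp flip: Suc_eq_plus1)
  have p: "(\<Prod>s = 1..horizon S. step_density \<pi> s \<theta> xA xB y) = ennreal p"
    unfolding p_def using n by (subst prod_ennreal[symmetric]) (auto simp: step_density_def ennreal_mult simp flip: Suc_eq_plus1 intro!: prod.cong)
  show ?thesis
    using n0 p0 unfolding joint_density_def history_density_def p_def[symmetric]
    by (simp add: ennreal_mult atLeastLessThanSuc_atLeastAtMost p mult.assoc)
qed

lemma joint_law_eq:
  assumes \<pi>: "\<pi> \<in> policies S"
  shows "joint_law S \<pi> = density (ref_param S \<Otimes>\<^sub>M traj (Suc (horizon S)))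
    (\<lambda>(\<theta>, xA, xB, y). ennreal (prior S \<theta>) * history_density \<pi> (Suc (horizon S)) \<theta> xA xB y)"
proof -
  have "joint_law S \<pi> = density (ref_param S \<Otimes>\<^sub>M traj (Suc (horizon S)))
      (\<lambda>(\<theta>, xA, xB, y). ennreal (joint_density S \<pi> \<theta> xA xB y))"
    by (simp add: joint_law_def atLeastLessThanSuc_atLeastAtMost flip: Suc_eq_plus1)
  also have "\<dots> = density (ref_param S \<Otimes>\<^sub>M traj (Suc (horizon S)))
    (\<lambda>(\<theta>, xA, xB, y). ennreal (prior S \<theta>) * history_density \<pi> (Suc (horizon S)) \<theta> xA xB y)"
    \<comment> \<open>The two densities agree only on the space. Comparing the defining integrals
      uses just that and asks for no measurability of \<open>joint_density\<close>.\<close>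
    unfolding density_def
    by (intro arg_cong[where f = "measure_of _ _"] ext nn_integral_cong)
      (auto simp: ennreal_joint_density[OF \<pi>] space_pair_measure atLeastLessThanSuc_atLeastAtMost)
  finally show ?thesis .
qed

section \<open>Laws of windows of the trajectory\<close>

lemma measurable_prior [measurable]: "prior S \<in> borel_measurable (ref_param S)"
  using prior by (simp add: is_density_def)

lemma sigma_finite_traj: "sigma_finite_measure (traj t)"
  by (simp add: pair_sigma_finite.intro sigma_finite_PA sigma_finite_PB_PY sigma_finite_pair_measure)

lemma sets_joint_law [measurable_cong]:
  "sets (joint_law S \<pi>) = sets (ref_param S \<Otimes>\<^sub>M traj (Suc (horizon S)))"
  by (simp add: joint_law_def atLeastLessThanSuc_atLeastAtMost flip: Suc_eq_plus1)

text \<open>The bridge from the joint law to the expectations at fixed \<open>\<theta>\<close>: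
  Tonelli with the parameter outermost.\<close>

lemma nn_integral_joint_law:
  assumes \<pi>: "\<pi> \<in> policies S"
    and F [measurable]: "F \<in> borel_measurable (ref_param S \<Otimes>\<^sub>M traj (Suc (horizon S)))"
  shows "(\<integral>\<^sup>+w. F w \<partial>joint_law S \<pi>) =
    (\<integral>\<^sup>+\<theta>. ennreal (prior S \<theta>) * expect \<pi> (Suc (horizon S)) \<theta> (\<lambda>xA xB y. F (\<theta>, xA, xB, y)) \<partial>ref_param S)"
proof -
  interpret T: sigma_finite_measure "traj (Suc (horizon S))"
    by (rule sigma_finite_traj)
  note [measurable (raw)] = measurable_history_density[OF \<pi>]
  have "(\<integral>\<^sup>+w. F w \<partial>joint_law S \<pi>) = (\<integral>\<^sup>+(\<theta>, xA, xB, y). ennreal (prior S \<theta>) *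
      history_density \<pi> (Suc (horizon S)) \<theta> xA xB y * F (\<theta>, xA, xB, y) \<partial>(ref_param S \<Otimes>\<^sub>M traj (Suc (horizon S))))"
    unfolding joint_law_eq[OF \<pi>] by (subst nn_integral_density) (auto simp: case_prod_unfold)
  also have "\<dots> = (\<integral>\<^sup>+\<theta>. \<integral>\<^sup>+(xA, xB, y). ennreal (prior S \<theta>) *
      (history_density \<pi> (Suc (horizon S)) \<theta> xA xB y * F (\<theta>, xA, xB, y)) \<partial>traj (Suc (horizon S)) \<partial>ref_param S)"
    by (subst T.nn_integral_fst[symmetric]) (auto simp: case_prod_unfold mult.assoc)
  also have "\<dots> = (\<integral>\<^sup>+\<theta>. ennreal (prior S \<theta>) * expect \<pi> (Suc (horizon S)) \<theta> (\<lambda>xA xB y. F (\<theta>, xA, xB, y)) \<partial>ref_param S)"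
  proof (rule nn_integral_cong)
    fix \<theta> assume [measurable]: "\<theta> \<in> space (ref_param S)"
    show "(\<integral>\<^sup>+(xA, xB, y). ennreal (prior S \<theta>) *
      (history_density \<pi> (Suc (horizon S)) \<theta> xA xB y * F (\<theta>, xA, xB, y)) \<partial>traj (Suc (horizon S))) =
      ennreal (prior S \<theta>) * expect \<pi> (Suc (horizon S)) \<theta> (\<lambda>xA xB y. F (\<theta>, xA, xB, y))"
      unfolding expect_def case_prod_unfold by (intro nn_integral_cmult) simp
  qed
  finally show ?thesis .
qed

text \<open>Large enough for the arguments of the cost and the distortion at time \<open>t\<close>
  and, when \<open>t\<close> is the horizon, for those of the mutual information; small enough for
  its law to be preserved.\<close>

abbreviation (input) window where
  "window t \<equiv> (\<lambda>(\<theta>, xA, xB, y). (\<theta>, xA t, xA (Suc t), restrict xB {1..Suc t}, restrict y {1..<Suc t}))"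

lemma measurable_window:
  assumes t: "t \<in> {1..horizon S}"
  shows "window t \<in> measurable (ref_param S \<Otimes>\<^sub>M traj (Suc (horizon S))) (ref_param S \<Otimes>\<^sub>M ref_A S \<Otimes>\<^sub>M snapshot (Suc t))"
proof -
  have [measurable]: "(\<lambda>w. restrict w {1..Suc t}) \<in> measurable (PB {1..Suc (horizon S)}) (PB {1..Suc t})"
    "(\<lambda>w. restrict w {1..<Suc t}) \<in> measurable (PY {1..<Suc (horizon S)}) (PY {1..<Suc t})"
    using t by (auto intro!: measurable_restrict)
  have "t \<in> {1..Suc (horizon S)}" "Suc t \<in> {1..Suc (horizon S)}"
    using t by auto
  then show ?thesis
    by measurable
qed

text \<open>For each fixed \<open>\<theta>\<close> the section of the indicator of \<open>E\<close>
  is a test function, so the integrands against the prior agree pointwise.\<close>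

lemma distr_joint_law_window:
  assumes \<pi>: "\<pi> \<in> policies S" and t: "t \<in> {1..horizon S}"
  defines "M \<equiv> ref_param S \<Otimes>\<^sub>M ref_A S \<Otimes>\<^sub>M snapshot (Suc t)"
  shows "distr (joint_law S \<pi>) M (window t) = distr (joint_law S (as_policy (simplify \<pi>))) M (window t)"
proof -
  have \<sigma>: "as_policy (simplify \<pi>) \<in> policies S"
    using as_policy_simplify[OF \<pi>] simplified_policies_subset by blast
  note [measurable] = measurable_window[OF t]
  show ?thesis
  proof (rule measure_eqI)
    fix E assume "E \<in> sets (distr (joint_law S \<pi>) M (window t))"
    then have E [measurable]: "E \<in> sets (ref_param S \<Otimes>\<^sub>M ref_A S \<Otimes>\<^sub>M snapshot (Suc t))"
      by (simp add: M_def)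
    have eq: "emeasure (distr (joint_law S \<tau>) M (window t)) E =
        (\<integral>\<^sup>+\<theta>. ennreal (prior S \<theta>) * expect \<tau> (Suc (horizon S)) \<theta> (\<lambda>xA xB y.
          indicator E (window t (\<theta>, xA, xB, y))) \<partial>ref_param S)" if \<tau>: "\<tau> \<in> policies S" for \<tau>
    proof -
      have "emeasure (distr (joint_law S \<tau>) M (window t)) E =
          (\<integral>\<^sup>+w. indicator E w \<partial>distr (joint_law S \<tau>) M (window t))"
        by (simp add: M_def)
      also have "\<dots> = (\<integral>\<^sup>+w. indicator E (window t w) \<partial>joint_law S \<tau>)"
        unfolding M_def by (intro nn_integral_distr) measurable
      finally show ?thesis
        by (simp add: nn_integral_joint_law[OF \<tau>])
    qed
    have "expect \<pi> (Suc (horizon S)) \<theta> (\<lambda>xA xB y. indicator E (window t (\<theta>, xA, xB, y))) =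
      expect (as_policy (simplify \<pi>)) (Suc (horizon S)) \<theta> (\<lambda>xA xB y. indicator E (window t (\<theta>, xA, xB, y)))"
      if \<theta> [measurable]: "\<theta> \<in> space (ref_param S)" for \<theta>
      using expect_horizon_as_policy_simplify[OF \<pi> \<theta> t, of "\<lambda>z. indicator E (\<theta>, z)"] by simp
    then show "emeasure (distr (joint_law S \<pi>) M (window t)) E =
        emeasure (distr (joint_law S (as_policy (simplify \<pi>))) M (window t)) E"
      unfolding eq[OF \<pi>] eq[OF \<sigma>] by (intro nn_integral_cong) simp
  qed (simp add: M_def)
qed

text \<open>Repeated Tonelli, arranged so that the nesting of the three inner integrals is exactly
  that in \<open>transition_density\<close>.\<close>

lemma nn_integral_split_coordinates:
  assumes "finite R" "i \<notin> R" "j \<notin> R" "i \<noteq> j" "finite J" "finite L" "k \<notin> L"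
    and I: "I = insert j (insert i R)" and K: "K = insert k L"
    and f: "f \<in> borel_measurable (PA I \<Otimes>\<^sub>M PB J \<Otimes>\<^sub>M PY K)"
  shows "(\<integral>\<^sup>+w. f w \<partial>(PA I \<Otimes>\<^sub>M PB J \<Otimes>\<^sub>M PY K)) =
    (\<integral>\<^sup>+(x, x', y). \<integral>\<^sup>+r. \<integral>\<^sup>+xB. \<integral>\<^sup>+ys. f (r(i := x, j := x'), xB, ys(k := y))
      \<partial>PY L \<partial>PB J \<partial>PA R \<partial>(ref_A S \<Otimes>\<^sub>M ref_A S \<Otimes>\<^sub>M ref_Y S))"
proof -
  interpret PR: sigma_finite_measure "PA R" by (rule sigma_finite_PA) fact
  interpret PJ: sigma_finite_measure "PB J" by (rule sigma_finite_PB) fact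
  interpret PL: sigma_finite_measure "PY L" by (rule sigma_finite_PY) fact
  interpret PK: sigma_finite_measure "PY K" by (rule sigma_finite_PY) (use assms in simp)
  interpret PJK: sigma_finite_measure "PB J \<Otimes>\<^sub>M PY K" using assms by (intro sigma_finite_PB_PY) auto
  interpret AY: sigma_finite_measure "ref_A S \<Otimes>\<^sub>M ref_Y S"
    by (intro sigma_finite_pair_measure sigma_finite_ref_A sigma_finite_ref_Y)
  interpret AA: pair_sigma_finite "ref_A S" "ref_A S" ..
  interpret JY: pair_sigma_finite "PB J" "ref_Y S" ..
  interpret RY: pair_sigma_finite "PA R" "ref_Y S" ..
  note [measurable] = f[unfolded I K]
  have "(\<integral>\<^sup>+w. f w \<partial>(PA I \<Otimes>\<^sub>M PB J \<Otimes>\<^sub>M PY K)) =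
      (\<integral>\<^sup>+p. \<integral>\<^sup>+xB. \<integral>\<^sup>+q. f (p, xB, q) \<partial>PY K \<partial>PB J \<partial>PA I)"
    using f by (subst PJK.nn_integral_fst[symmetric]) (auto intro!: nn_integral_cong PK.nn_integral_fst[symmetric])
  also have "\<dots> = (\<integral>\<^sup>+p. \<integral>\<^sup>+xB. \<integral>\<^sup>+y. \<integral>\<^sup>+ys. f (p, xB, ys(k := y)) \<partial>PY L \<partial>ref_Y S \<partial>PB J \<partial>PA I)"
    unfolding I K using assms
    by (intro nn_integral_cong Y.product_nn_integral_insert_rev) measurable
  also have "\<dots> = (\<integral>\<^sup>+x'. \<integral>\<^sup>+p. \<integral>\<^sup>+xB. \<integral>\<^sup>+y. \<integral>\<^sup>+ys. f (p(j := x'), xB, ys(k := y))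
      \<partial>PY L \<partial>ref_Y S \<partial>PB J \<partial>PA (insert i R) \<partial>ref_A S)"
    unfolding I using assms by (intro A.product_nn_integral_insert_rev) measurable
  also have "\<dots> = (\<integral>\<^sup>+x'. \<integral>\<^sup>+x. \<integral>\<^sup>+r. \<integral>\<^sup>+xB. \<integral>\<^sup>+y. \<integral>\<^sup>+ys. f (r(i := x, j := x'), xB, ys(k := y))
      \<partial>PY L \<partial>ref_Y S \<partial>PB J \<partial>PA R \<partial>ref_A S \<partial>ref_A S)"
    using assms by (intro nn_integral_cong A.product_nn_integral_insert_rev) measurable
  also have "\<dots> = (\<integral>\<^sup>+x. \<integral>\<^sup>+x'. \<integral>\<^sup>+r. \<integral>\<^sup>+xB. \<integral>\<^sup>+y. \<integral>\<^sup>+ys. f (r(i := x, j := x'), xB, ys(k := y))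
      \<partial>PY L \<partial>ref_Y S \<partial>PB J \<partial>PA R \<partial>ref_A S \<partial>ref_A S)"
    by (intro AA.Fubini') measurable
  also have "\<dots> = (\<integral>\<^sup>+x. \<integral>\<^sup>+x'. \<integral>\<^sup>+r. \<integral>\<^sup>+y. \<integral>\<^sup>+xB. \<integral>\<^sup>+ys. f (r(i := x, j := x'), xB, ys(k := y))
      \<partial>PY L \<partial>PB J \<partial>ref_Y S \<partial>PA R \<partial>ref_A S \<partial>ref_A S)"
    by (intro nn_integral_cong JY.Fubini'[symmetric]) measurable
  also have "\<dots> = (\<integral>\<^sup>+x. \<integral>\<^sup>+x'. \<integral>\<^sup>+y. \<integral>\<^sup>+r. \<integral>\<^sup>+xB. \<integral>\<^sup>+ys. f (r(i := x, j := x'), xB, ys(k := y))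
      \<partial>PY L \<partial>PB J \<partial>PA R \<partial>ref_Y S \<partial>ref_A S \<partial>ref_A S)"
    by (intro nn_integral_cong RY.Fubini'[symmetric]) measurable
  also have "\<dots> = (\<integral>\<^sup>+x. \<integral>\<^sup>+(x', y). \<integral>\<^sup>+r. \<integral>\<^sup>+xB. \<integral>\<^sup>+ys. f (r(i := x, j := x'), xB, ys(k := y))
      \<partial>PY L \<partial>PB J \<partial>PA R \<partial>(ref_A S \<Otimes>\<^sub>M ref_Y S) \<partial>ref_A S)"
    unfolding case_prod_unfold
    by (intro nn_integral_cong, subst sigma_finite_measure.nn_integral_fst[OF sigma_finite_ref_Y, symmetric]) measurable
  also have "\<dots> = (\<integral>\<^sup>+(x, x', y). \<integral>\<^sup>+r. \<integral>\<^sup>+xB. \<integral>\<^sup>+ys. f (r(i := x, j := x'), xB, ys(k := y))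
      \<partial>PY L \<partial>PB J \<partial>PA R \<partial>(ref_A S \<Otimes>\<^sub>M ref_A S \<Otimes>\<^sub>M ref_Y S))"
    unfolding case_prod_unfold
    by (subst AY.nn_integral_fst[symmetric]) measurable
  finally show ?thesis .
qed

text \<open>Expresses the cost at one parameter value through \<open>expect\<close> at that value.
  The law of the window alone would not do, since a single point may be null for the parameter
  measure.\<close>

lemma nn_integral_transition_density:
  assumes \<pi>: "\<pi> \<in> policies S" and \<theta>: "\<theta> \<in> space (ref_param S)" and t: "t \<in> {1..horizon S}"
    and h [measurable]: "h \<in> borel_measurable (ref_A S \<Otimes>\<^sub>M ref_A S \<Otimes>\<^sub>M ref_Y S)"
  shows "(\<integral>\<^sup>+w. h w \<partial>density (ref_A S \<Otimes>\<^sub>M ref_A S \<Otimes>\<^sub>M ref_Y S)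
      (\<lambda>(x, x', y). transition_density S \<pi> t \<theta> x x' y)) =
    ennreal (prior S \<theta>) * expect \<pi> (Suc (horizon S)) \<theta> (\<lambda>xA xB y. h (xA t, xA (Suc t), y t))"
proof -
  let ?T = "Suc (horizon S)"
  let ?R = "{1..?T} - {t, Suc t}" and ?L = "{1..<?T} - {t}"
  let ?W = "ref_A S \<Otimes>\<^sub>M ref_A S \<Otimes>\<^sub>M ref_Y S"
  define H where "H xA xB y = ennreal (prior S \<theta>) * history_density \<pi> ?T \<theta> xA xB y" for xA xB y
  note [measurable] = \<theta>
  note [measurable (raw)] = measurable_history_density[OF \<pi>]
  interpret PB: sigma_finite_measure "PB {1..?T}" by (rule sigma_finite_PB) simp
  interpret PR: sigma_finite_measure "PA ?R" by (rule sigma_finite_PA) simp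
  interpret PL: sigma_finite_measure "PY ?L" by (rule sigma_finite_PY) simp
  have I: "{1..?T} = insert (Suc t) (insert t ?R)" and K: "{1..<?T} = insert t ?L"
    using t by auto
  \<comment> \<open>Measurability rules for gluing: the inner integrals run over an interval with
    points removed, while the history density needs the whole interval.\<close>
  have upd_A: "(\<lambda>w. (f w)(t := a w, Suc t := b w)) \<in> measurable N (PA {1..?T})"
    if "f \<in> measurable N (PA ?R)" "a \<in> measurable N (ref_A S)" "b \<in> measurable N (ref_A S)"
    for f a b and N :: "'z measure"
    by (subst I) (intro measurable_fun_upd_insert that)
  have upd_Y: "(\<lambda>w. (f w)(t := a w)) \<in> measurable N (PY {1..<?T})"
    if "f \<in> measurable N (PY ?L)" "a \<in> measurable N (ref_Y S)" for f a and N :: "'z measure"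
    by (subst K) (intro measurable_fun_upd_insert that)
  define q where "q = (\<lambda>(x, x', y). \<integral>\<^sup>+r. \<integral>\<^sup>+xB. \<integral>\<^sup>+ys.
    H (r(t := x, Suc t := x')) xB (ys(t := y)) \<partial>PY ?L \<partial>PB {1..?T} \<partial>PA ?R)"
  have mH: "(\<lambda>w. H (f w) (b w) (y w)) \<in> borel_measurable N"
    if "f \<in> measurable N (PA {1..?T})" "b \<in> measurable N (PB {1..?T})" "y \<in> measurable N (PY {1..<?T})"
    for f b y and N :: "'z measure"
    unfolding H_def using that by measurable
  note [measurable (raw)] = upd_A upd_Y mH
  have q [measurable]: "q \<in> borel_measurable ?W"
    unfolding q_def case_prod_unfold by measurable
  have "transition_density S \<pi> t \<theta> x x' y = q (x, x', y)"
    if "x \<in> space (ref_A S)" "x' \<in> space (ref_A S)" "y \<in> space (ref_Y S)" for x x' y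
    unfolding transition_density_def q_def prod.case H_def
      atLeastLessThanSuc_atLeastAtMost Suc_eq_plus1[symmetric]
  proof (intro nn_integral_cong ennreal_joint_density[OF \<pi> \<theta>])
    fix r ys
    assume "r \<in> space (PA ?R)" "ys \<in> space (PY ({1..horizon S} - {t}))"
    then show "r(t := x, Suc t := x') \<in> space (PA {1..?T})" "ys(t := y) \<in> space (PY {1..horizon S})"
      using that t by (auto simp: space_PiM PiE_def extensional_def Pi_iff)
  qed
  then have "density ?W (\<lambda>(x, x', y). transition_density S \<pi> t \<theta> x x' y) = density ?W q"
    unfolding density_def
    by (intro arg_cong[where f = "measure_of _ _"] ext nn_integral_cong) (auto simp: space_pair_measure)
  then have "(\<integral>\<^sup>+w. h w \<partial>density ?W (\<lambda>(x, x', y). transition_density S \<pi> t \<theta> x x' y)) =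
      (\<integral>\<^sup>+w. q w * h w \<partial>?W)"
    by (simp add: nn_integral_density)
  also have "\<dots> = (\<integral>\<^sup>+(x, x', y). \<integral>\<^sup>+r. \<integral>\<^sup>+xB. \<integral>\<^sup>+ys. (\<lambda>(xA, xB, y). H xA xB y * h (xA t, xA (Suc t), y t))
      (r(t := x, Suc t := x'), xB, ys(t := y)) \<partial>PY ?L \<partial>PB {1..?T} \<partial>PA ?R \<partial>?W)"
  proof (rule nn_integral_cong)
    fix w assume "w \<in> space ?W"
    moreover obtain x x' y where w_eq: "w = (x, x', y)"
      by (metis surj_pair)
    ultimately have w: "(x, x', y) \<in> space ?W"
      by simp
    have [measurable]: "x \<in> space (ref_A S)" "x' \<in> space (ref_A S)" "y \<in> space (ref_Y S)"
      using w by (auto simp: space_pair_measure)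
    \<comment> \<open>The updated trajectories have the values \<open>x\<close>, \<open>x'\<close>
      and \<open>y\<close> at the split-off times, so \<open>h\<close> is constant for the inner
      integrals and can be moved under them.\<close>
    have "q (x, x', y) * h (x, x', y) = (\<integral>\<^sup>+r. \<integral>\<^sup>+xB. \<integral>\<^sup>+ys.
        H (r(t := x, Suc t := x')) xB (ys(t := y)) * h (x, x', y) \<partial>PY ?L \<partial>PB {1..?T} \<partial>PA ?R)"
      by (simp add: q_def nn_integral_multc cong: nn_integral_cong_simp)
    then show "q w * h w = (case w of (x, x', y) \<Rightarrow> \<integral>\<^sup>+r. \<integral>\<^sup>+xB. \<integral>\<^sup>+ys.
        (\<lambda>(xA, xB, y). H xA xB y * h (xA t, xA (Suc t), y t)) (r(t := x, Suc t := x'), xB, ys(t := y))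
        \<partial>PY ?L \<partial>PB {1..?T} \<partial>PA ?R)"
      by (simp add: w_eq)
  qed
  also have "\<dots> = (\<integral>\<^sup>+(xA, xB, y). H xA xB y * h (xA t, xA (Suc t), y t) \<partial>traj ?T)"
  proof (intro nn_integral_split_coordinates[symmetric] I K)
    have "t \<in> {1..?T}" "Suc t \<in> {1..?T}" "t \<in> {1..<?T}"
      using t by auto
    then show "(\<lambda>(xA, xB, y). H xA xB y * h (xA t, xA (Suc t), y t)) \<in> borel_measurable (traj ?T)"
      unfolding H_def by measurable
  qed auto
  also have "\<dots> = ennreal (prior S \<theta>) * expect \<pi> ?T \<theta> (\<lambda>xA xB y. h (xA t, xA (Suc t), y t))"
  proof -
    have "t \<in> {1..?T}" "Suc t \<in> {1..?T}" "t \<in> {1..<?T}"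
      using t by auto
    then show ?thesis
      unfolding H_def expect_def case_prod_unfold mult.assoc by (intro nn_integral_cmult) measurable
  qed
  finally show ?thesis .
qed

text \<open>The integrals of the positive and negative parts agree separately, so the extended-real
  values agree even when both parts are infinite.\<close>

lemma expected_cost_simplify:
  assumes \<pi>: "\<pi> \<in> policies S" and t: "t \<in> {1..horizon S}"
  shows "expected_cost S (as_policy (simplify \<pi>)) t = expected_cost S \<pi> t"
proof -
  have \<sigma>: "as_policy (simplify \<pi>) \<in> policies S"
    using as_policy_simplify[OF \<pi>] simplified_policies_subset by blast
  note [measurable] = true_param
  have [measurable]: "(\<lambda>w. cost S (true_param S) (fst w) (fst (snd w)) (snd (snd w))) \<in>
      borel_measurable (ref_A S \<Otimes>\<^sub>M ref_A S \<Otimes>\<^sub>M ref_Y S)"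
    using measurable_compose[OF measurable_Pair1'[OF true_param] measurable_cost]
    by (simp add: case_prod_unfold)
  \<comment> \<open>The data shared at time \<open>t\<close> lie inside the window, whose
    \<open>y\<close> ends at \<open>t\<close> rather than \<open>t - 1\<close>.\<close>
  have t': "t \<in> {1..<Suc t}"
    using t by auto
  have "(\<integral>\<^sup>+w. h w \<partial>density (ref_A S \<Otimes>\<^sub>M ref_A S \<Otimes>\<^sub>M ref_Y S)
      (\<lambda>(x, x', y). transition_density S (as_policy (simplify \<pi>)) t (true_param S) x x' y)) =
    (\<integral>\<^sup>+w. h w \<partial>density (ref_A S \<Otimes>\<^sub>M ref_A S \<Otimes>\<^sub>M ref_Y S)
      (\<lambda>(x, x', y). transition_density S \<pi> t (true_param S) x x' y))"
    if [measurable]: "h \<in> borel_measurable (ref_A S \<Otimes>\<^sub>M ref_A S \<Otimes>\<^sub>M ref_Y S)" for h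
  proof -
    have "(\<lambda>(x, x', xB, y). h (x, x', y t)) \<in> borel_measurable (ref_A S \<Otimes>\<^sub>M snapshot (Suc t))"
      using t' by measurable
    from expect_horizon_as_policy_simplify[OF \<pi> true_param t this] t' show ?thesis
      by (simp add: nn_integral_transition_density[OF \<pi> true_param t that]
        nn_integral_transition_density[OF \<sigma> true_param t that])
  qed
  then show ?thesis
    unfolding expected_cost_def ereal_integral_def case_prod_unfold by simp
qed

section \<open>Distortion and mutual information\<close>

lemma measurable_window_joint_law:
  "t \<in> {1..horizon S} \<Longrightarrow>
    window t \<in> measurable (joint_law S \<pi>) (ref_param S \<Otimes>\<^sub>M ref_A S \<Otimes>\<^sub>M snapshot (Suc t))"
  using measurable_window measurable_cong_sets[OF sets_joint_law refl] by blast

lemma nn_integral_joint_law_window: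
  assumes \<pi>: "\<pi> \<in> policies S" and t: "t \<in> {1..horizon S}"
    and [measurable]: "g \<in> borel_measurable (ref_param S \<Otimes>\<^sub>M ref_A S \<Otimes>\<^sub>M snapshot (Suc t))"
  shows "(\<integral>\<^sup>+w. g (window t w) \<partial>joint_law S (as_policy (simplify \<pi>))) = (\<integral>\<^sup>+w. g (window t w) \<partial>joint_law S \<pi>)"
proof -
  have "(\<integral>\<^sup>+w. g (window t w) \<partial>joint_law S \<tau>) =
      (\<integral>\<^sup>+v. g v \<partial>distr (joint_law S \<tau>) (ref_param S \<Otimes>\<^sub>M ref_A S \<Otimes>\<^sub>M snapshot (Suc t)) (window t))" for \<tau>
    by (intro nn_integral_distr[symmetric] measurable_window_joint_law t) simp
  then show ?thesis
    by (simp add: distr_joint_law_window[OF \<pi> t])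
qed

lemma expected_distortion_simplify:
  assumes \<pi>: "\<pi> \<in> policies S" and t: "t \<in> {1..horizon S}"
  shows "expected_distortion S (as_policy (simplify \<pi>)) t = expected_distortion S \<pi> t"
proof -
  have t': "t \<in> {1..<Suc t}"
    using t by auto
  have d: "(\<lambda>(\<theta>, x, x', xB, y). dist_fun S x (y t)) \<in>
      borel_measurable (ref_param S \<Otimes>\<^sub>M ref_A S \<Otimes>\<^sub>M snapshot (Suc t))"
  proof -
    have "(\<lambda>(\<theta>, x, x', xB, y). (x, y t)) \<in>
        measurable (ref_param S \<Otimes>\<^sub>M ref_A S \<Otimes>\<^sub>M snapshot (Suc t)) (ref_A S \<Otimes>\<^sub>M ref_Y S)"
      using t' by measurable
    from measurable_compose[OF this measurable_dist_fun] show ?thesis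
      by (simp add: case_prod_unfold)
  qed
  \<comment> \<open>Stated for any \<open>f\<close> to cover the positive and the negative part of
    the distortion at once.\<close>
  have "(\<integral>\<^sup>+(\<theta>, xA, xB, y). f (dist_fun S (xA t) (y t)) \<partial>joint_law S (as_policy (simplify \<pi>))) =
      (\<integral>\<^sup>+(\<theta>, xA, xB, y). f (dist_fun S (xA t) (y t)) \<partial>joint_law S \<pi>)"
    if f: "f \<in> borel_measurable borel" for f :: "real \<Rightarrow> ennreal"
    using nn_integral_joint_law_window[OF \<pi> t measurable_compose[OF d f]] t'
    by (simp add: case_prod_unfold)

  from this[of ennreal] this[of "\<lambda>x. ennreal (- x)"] show ?thesis
    unfolding expected_distortion_def ereal_integral_def case_prod_unfold by simp
qed

text \<open>A variable that factors through a window has the same law under both policies. The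
  factorisation is asked for only on the space, since a restriction to the full index set is the
  identity only there.\<close>

lemma distr_joint_law_simplify:
  assumes \<pi>: "\<pi> \<in> policies S" and t: "t \<in> {1..horizon S}"
    and f: "f \<in> measurable (ref_param S \<Otimes>\<^sub>M ref_A S \<Otimes>\<^sub>M snapshot (Suc t)) N"
    and X: "\<And>w. w \<in> space (ref_param S \<Otimes>\<^sub>M traj (Suc (horizon S))) \<Longrightarrow> X w = f (window t w)"
  shows "distr (joint_law S (as_policy (simplify \<pi>))) N X = distr (joint_law S \<pi>) N X"
proof -
  have "distr (joint_law S \<tau>) N X =
      distr (distr (joint_law S \<tau>) (ref_param S \<Otimes>\<^sub>M ref_A S \<Otimes>\<^sub>M snapshot (Suc t)) (window t)) N f" for \<tau>
  proof -
    have "distr (joint_law S \<tau>) N X = distr (joint_law S \<tau>) N (f \<circ> window t)"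
      using X sets_eq_imp_space_eq[OF sets_joint_law] by (intro distr_cong) auto
    also have "\<dots> = distr (distr (joint_law S \<tau>) (ref_param S \<Otimes>\<^sub>M ref_A S \<Otimes>\<^sub>M snapshot (Suc t)) (window t)) N f"
      by (intro distr_distr[symmetric] f measurable_window_joint_law t)
    finally show ?thesis .
  qed
  then show ?thesis
    by (simp add: distr_joint_law_window[OF \<pi> t])
qed

lemma prob_space_joint_law:
  assumes \<pi>: "\<pi> \<in> policies S"
  shows "prob_space (joint_law S \<pi>)"
proof
  have "emeasure (joint_law S \<pi>) (space (joint_law S \<pi>)) = (\<integral>\<^sup>+w. 1 \<partial>joint_law S \<pi>)"
    by simp
  also have "\<dots> = (\<integral>\<^sup>+\<theta>. ennreal (prior S \<theta>) \<partial>ref_param S)"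
    by (subst nn_integral_joint_law[OF \<pi>])
      (auto intro!: nn_integral_cong simp: expect_one[OF \<pi>])
  also have "\<dots> = 1"
    using prior by (simp add: is_density_def)
  finally show "emeasure (joint_law S \<pi>) (space (joint_law S \<pi>)) = 1" .
qed

text \<open>Besides the mutual information, the guards for absolute continuity and integrability
  also depend only on the joint law of the two variables and its two marginals. All three are read
  off the window at the horizon.\<close>

lemma privacy_loss_simplify:
  assumes \<pi>: "\<pi> \<in> policies S"
  shows "privacy_loss S (as_policy (simplify \<pi>)) = privacy_loss S \<pi>"
proof (cases "horizon S = 0")
  \<comment> \<open>There is no window at time \<open>0\<close>, but the product over steps is empty
    and the joint law involves no policy.\<close>
  case True
  then show ?thesis
    by (simp add: privacy_loss_def joint_law_def joint_density_def)
next
  case False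
  let ?T = "horizon S"
  let ?X = "\<lambda>(\<theta>, xA, xB, y). \<theta>" and ?Y = "\<lambda>(\<theta>, xA, xB, y). (y, restrict xB {1..?T})"
  let ?f = "\<lambda>(\<theta>, x, x', xB, y). (y, restrict xB {1..?T})"
  have T: "?T \<in> {1..?T}"
    using False by auto
  have [measurable]: "(\<lambda>w. restrict w {1..?T}) \<in> measurable (PB {1..Suc ?T}) (PB {1..?T})"
    by (auto intro!: measurable_restrict)
  have f [measurable]: "?f \<in> measurable (ref_param S \<Otimes>\<^sub>M ref_A S \<Otimes>\<^sub>M snapshot (Suc ?T)) (PY {1..?T} \<Otimes>\<^sub>M PB {1..?T})"
    unfolding atLeastLessThanSuc_atLeastAtMost by measurable
  have eq: "?Y w = ?f (window ?T w)" if w: "w \<in> space (ref_param S \<Otimes>\<^sub>M traj (Suc ?T))" for w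
  proof -
    obtain \<theta> xA xB y where w_eq: "w = (\<theta>, xA, xB, y)"
      by (metis surj_pair)
    have "{1..Suc ?T} \<inter> {1..?T} = {1..?T}"
      by auto
    moreover have "restrict y {1..<Suc ?T} = y"
      using w by (intro restrict_space_PiM[where M = "\<lambda>_. ref_Y S"]) (simp add: w_eq space_pair_measure)
    ultimately show ?thesis
      by (simp add: w_eq)
  qed
  have eq': "(?X w, ?Y w) = (fst (window ?T w), ?f (window ?T w))"
    if w: "w \<in> space (ref_param S \<Otimes>\<^sub>M traj (Suc ?T))" for w
    by (subst eq[OF w]) (simp add: case_prod_unfold)
  have X: "distr (joint_law S (as_policy (simplify \<pi>))) (ref_param S) ?X = distr (joint_law S \<pi>) (ref_param S) ?X"
    by (rule distr_joint_law_simplify[OF \<pi> T, of fst]) auto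
  have Y: "distr (joint_law S (as_policy (simplify \<pi>))) (PY {1..?T} \<Otimes>\<^sub>M PB {1..?T}) ?Y =
      distr (joint_law S \<pi>) (PY {1..?T} \<Otimes>\<^sub>M PB {1..?T}) ?Y"
    by (rule distr_joint_law_simplify[OF \<pi> T f eq])
  have XY: "distr (joint_law S (as_policy (simplify \<pi>))) (ref_param S \<Otimes>\<^sub>M PY {1..?T} \<Otimes>\<^sub>M PB {1..?T}) (\<lambda>w. (?X w, ?Y w)) =
      distr (joint_law S \<pi>) (ref_param S \<Otimes>\<^sub>M PY {1..?T} \<Otimes>\<^sub>M PB {1..?T}) (\<lambda>w. (?X w, ?Y w))"
    by (rule distr_joint_law_simplify[OF \<pi> T measurable_Pair[OF measurable_fst f] eq'])
  have \<sigma>: "as_policy (simplify \<pi>) \<in> policies S"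
    using as_policy_simplify[OF \<pi>] simplified_policies_subset by blast
  \<comment> \<open>\<open>mutual_information\<close> belongs to a locale of probability spaces, so
    its definition unfolds only once the joint law is known to be one.\<close>
  note mi = prob_space.mutual_information_def[OF prob_space_joint_law]
  show ?thesis
    unfolding privacy_loss_def ereal_mutual_information_def mi[OF \<pi>] mi[OF \<sigma>] Let_def X Y XY
    by (rule refl)
qed

lemma objective_simplify:
  "\<pi> \<in> policies S \<Longrightarrow> objective S (as_policy (simplify \<pi>)) = objective S \<pi>"
  by (simp add: objective_def privacy_loss_simplify expected_cost_simplify)

end

theorem theorem1:
  fixes S :: "('p, real ^ 'na, real ^ 'nb, 'y) data_sharing"
    and \<pi>opt :: "('p, real ^ 'na, real ^ 'nb, 'y) policy"
  assumes "data_sharing_problem S"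
    and "optimal S \<pi>opt"
  shows "\<exists>\<pi>s \<in> simplified_policies S.
           optimal S \<pi>s \<and>
           objective S \<pi>s = objective S \<pi>opt \<and>
           (\<forall>t\<in>{1..horizon S}. expected_distortion S \<pi>s t \<le> ereal (dist_bound S))"
proof -
  interpret data_sharing_problem S by fact
  let ?\<pi>s = "as_policy (simplify \<pi>opt)"
  have feas: "feasible S \<pi>opt"
    using assms(2) by (simp add: optimal_def is_arg_min_def)
  then have \<pi>: "\<pi>opt \<in> policies S"
    by (simp add: feasible_def)
  have s: "?\<pi>s \<in> simplified_policies S"
    by (rule as_policy_simplify[OF \<pi>])
  have dist: "\<forall>t\<in>{1..horizon S}. expected_distortion S ?\<pi>s t \<le> ereal (dist_bound S)"
    using feas by (simp add: feasible_def expected_distortion_simplify[OF \<pi>])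
  have "feasible S ?\<pi>s"
    using s dist simplified_policies_subset by (auto simp: feasible_def)
  \<comment> \<open>The new policy is feasible with the same objective value, so any strictly better
    feasible policy would also beat \<open>\<pi>opt\<close>.\<close>
  then have "optimal S ?\<pi>s"
    using assms(2) by (simp add: optimal_def is_arg_min_def objective_simplify[OF \<pi>])
  with s dist show ?thesis
    using objective_simplify[OF \<pi>] by blast
qed

end
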